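(* Let $E$ be an $(n+m)$-dimensional smooth manifold and let $\Gamma$ be a torsion-free linear connection on $TE\to E$ with Christoffel symbols $\Gamma_A{}^C{}_B$ in a local chart $(u^\lambda,u^i)$ of $E$. The following quantities $$\Gamma_\lambda{}^k{}_\xi,$$ $$\delta_\xi^\beta\,\Gamma_\lambda{}^k{}_i+\delta_\lambda^\beta\,\Gamma_i{}^k{}_\xi-\delta_i^k\,\Gamma_\lambda{}^\beta{}_\xi,$$ $$\delta_\lambda^\alpha\,\delta_\xi^\beta\,\Gamma_j{}^k{}_i-\delta^\alpha_\xi\,\delta^k_i\,\Gamma_\lambda{}^\beta{}_j-\delta_\lambda^\alpha\,\delta_i^k\,\Gamma_j{}^\beta{}_\xi,$$ $$\Gamma_j{}^\beta{}_i$$ are $n$-Grassmannian invariants, that is, they do not change for a connection which is $n$-Grassmannian equivalent to $\Gamma$.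
   Context: Greek indices run from $1$ to $n$, lower-case Latin indices from $n+1$ to $n+m$, and capital indices from $1$ to $n+m$; $\nabla_{\partial_A}\partial_B=\Gamma_A{}^C{}_B\,\partial_C$. $J^2(E,n)$ is the manifold of second-order contact classes $[L]^2_p$ of $n$-dimensional embedded submanifolds $L\subset E$. Its coordinates are $(u^\lambda,u^i,u^i_\lambda,u^i_{\lambda\xi})$, where $u^i_\lambda$ and $u^i_{\lambda\xi}$ are the first and second derivatives of the functions $f^i$ when $L$ is locally $u^i=f^i(u^1,\dots,u^n)$. The equation of (unparametrized) $n$-dimensional totally geodesic submanifolds of $\Gamma$ is the submanifold of $J^2(E,n)$ consisting of those $[L]^2_p$ for which the second fundamental form $(X,Y)\mapsto\nabla_XY \bmod T_pL$ of $L$ vanishes at $p$. Locally it is $$u^k_{\lambda\xi}+\Gamma_\lambda{}^k{}_\xi+\Gamma_\lambda{}^k{}_i\,u^i_\xi+\Gamma_j{}^k{}_\xi\,u^j_\lambda+\Gamma_j{}^k{}_i\,u^j_\lambda u^i_\xi-u^k_\beta\left(\Gamma_\lambda{}^\beta{}_\xi+\Gamma_\lambda{}^\beta{}_i\,u^i_\xi+\Gamma_j{}^\beta{}_\xi\,u^j_\lambda+\Gamma_j{}^\beta{}_i\,u^j_\lambda u^i_\xi\right)=0.$$ Two torsion-free linear connections on $TE\to E$ are $n$-Grassmannian equivalent if they have the same equation of $n$-dimensional totally geodesic submanifolds.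
   Formalization: The third quantity is symmetrized under exchange of (α,j) and (β,i): the literal one is not invariant, e.g. n=1, m=2, Γ=0, Γ' = δ^C_A φ_B + δ^C_B φ_A with φ=du³ are equivalent but Γ_2^2_3 changes from 0 to 1. *)

theory Defs
  imports "HOL-Analysis.Analysis"
begin

section \<open>Smooth manifolds\<close>

text \<open>\<open>smooth_on f S\<close> is only meant for open \<open>S\<close>, where it is the usual
  \<open>C\<^sup>\<infinity>\<close> notion: all iterated directional derivatives exist and are continuous.\<close>

primrec Ck_on :: "nat \<Rightarrow> ('a::real_normed_vector \<Rightarrow> 'b::real_normed_vector) \<Rightarrow> 'a set \<Rightarrow> bool" where
  "Ck_on 0 f S \<longleftrightarrow> continuous_on S f"
| "Ck_on (Suc k) f S \<longleftrightarrow>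
     (\<forall>x\<in>S. f differentiable (at x)) \<and> (\<forall>v. Ck_on k (\<lambda>x. frechet_derivative f (at x) v) S)"

definition smooth_on :: "('a::real_normed_vector \<Rightarrow> 'b::real_normed_vector) \<Rightarrow> 'a set \<Rightarrow> bool" where
  "smooth_on f S \<longleftrightarrow> (\<forall>k. Ck_on k f S)"

text \<open>The manifold \<open>E\<close> is the whole type \<open>'e\<close>.  Coordinates are indexed by \<open>'n + 'm\<close>: \<open>Inl \<lambda>\<close> is
  a Greek index (the first \<open>n\<close> coordinates), \<open>Inr i\<close> a Latin index (the last \<open>m\<close> ones), so that
  \<open>n = CARD('n)\<close> and \<open>m = CARD('m)\<close>.  A chart is its domain together with its coordinate map;
  values of the map outside the domain are irrelevant.\<close>

type_synonym ('e, 'n, 'm) chart = "'e set \<times> ('e \<Rightarrow> real ^ ('n + 'm))"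

abbreviation dom_of :: "('e, 'n, 'm) chart \<Rightarrow> 'e set" where
  "dom_of c \<equiv> fst c"

abbreviation coord :: "('e, 'n, 'm) chart \<Rightarrow> 'e \<Rightarrow> real ^ ('n + 'm)" where
  "coord c \<equiv> snd c"

definition coord_inv :: "('e, 'n::finite, 'm::finite) chart \<Rightarrow> real ^ ('n + 'm) \<Rightarrow> 'e" where
  "coord_inv c = inv_into (dom_of c) (coord c)"

definition is_chart :: "('e::topological_space, 'n::finite, 'm::finite) chart \<Rightarrow> bool" where
  "is_chart c \<longleftrightarrow> open (dom_of c) \<and> open (coord c ` dom_of c) \<and>
     homeomorphism (dom_of c) (coord c ` dom_of c) (coord c) (coord_inv c)"

definition transition ::
  "('e, 'n::finite, 'm::finite) chart \<Rightarrow> ('e, 'n, 'm) chart \<Rightarrow> real ^ ('n + 'm) \<Rightarrow> real ^ ('n + 'm)" where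
  "transition c d = coord d \<circ> coord_inv c"

definition compatible ::
  "('e::topological_space, 'n::finite, 'm::finite) chart \<Rightarrow> ('e, 'n, 'm) chart \<Rightarrow> bool" where
  "compatible c d \<longleftrightarrow>
     smooth_on (transition c d) (coord c ` (dom_of c \<inter> dom_of d)) \<and>
     smooth_on (transition d c) (coord d ` (dom_of c \<inter> dom_of d))"

text \<open>The atlas is maximal, so its members are all the local charts of the manifold.\<close>

definition smooth_manifold ::
  "('e::{t2_space, second_countable_topology}, 'n::finite, 'm::finite) chart set \<Rightarrow> bool" where
  "smooth_manifold A \<longleftrightarrow>
     (\<forall>c\<in>A. is_chart c) \<and> (\<Union>c\<in>A. dom_of c) = UNIV \<and> (\<forall>c\<in>A. \<forall>d\<in>A. compatible c d) \<and>
     (\<forall>c. is_chart c \<and> (\<forall>d\<in>A. compatible c d) \<longrightarrow> c \<in> A)"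

definition smooth_function ::
  "('e::topological_space, 'n::finite, 'm::finite) chart set \<Rightarrow> 'e set \<Rightarrow> ('e \<Rightarrow> real) \<Rightarrow> bool" where
  "smooth_function A W f \<longleftrightarrow> (\<forall>c\<in>A. smooth_on (f \<circ> coord_inv c) (coord c ` (W \<inter> dom_of c)))"


section \<open>Tangent vectors and vector fields\<close>

text \<open>A tangent vector at \<open>p\<close> is the family of its component vectors in all charts around \<open>p\<close>,
  related by the Jacobians of the coordinate changes (and \<open>0\<close> at all other arguments, so that
  equality of tangent vectors is equality of functions).\<close>

type_synonym ('e, 'n, 'm) tangent = "('e, 'n, 'm) chart \<Rightarrow> real ^ ('n + 'm)"

definition tangent_space ::
  "('e, 'n::finite, 'm::finite) chart set \<Rightarrow> 'e \<Rightarrow> ('e, 'n, 'm) tangent set" where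
  "tangent_space A p = {v.
     (\<forall>c\<in>A. \<forall>d\<in>A. p \<in> dom_of c \<and> p \<in> dom_of d \<longrightarrow>
        v d = frechet_derivative (transition c d) (at (coord c p)) (v c)) \<and>
     (\<forall>c. c \<notin> A \<or> p \<notin> dom_of c \<longrightarrow> v c = 0)}"

definition vector_field ::
  "('e::topological_space, 'n::finite, 'm::finite) chart set \<Rightarrow> 'e set \<Rightarrow>
     ('e \<Rightarrow> ('e, 'n, 'm) tangent) \<Rightarrow> bool" where
  "vector_field A W X \<longleftrightarrow>
     (\<forall>p\<in>W. X p \<in> tangent_space A p) \<and>
     (\<forall>c\<in>A. smooth_on (\<lambda>x. X (coord_inv c x) c) (coord c ` (W \<inter> dom_of c)))"

text \<open>The coordinate field \<open>\<partial>\<^sub>B\<close> of the chart \<open>c\<close>, on the domain of \<open>c\<close>.\<close>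

definition coord_field ::
  "('e, 'n::finite, 'm::finite) chart set \<Rightarrow> ('e, 'n, 'm) chart \<Rightarrow> 'n + 'm \<Rightarrow>
     'e \<Rightarrow> ('e, 'n, 'm) tangent" where
  "coord_field A c B q = (\<lambda>d. if d \<in> A \<and> q \<in> dom_of d
     then frechet_derivative (transition c d) (at (coord c q)) (axis B 1) else 0)"

text \<open>The derivative of a (scalar or \<open>\<real>\<^sup>N\<close>-valued) function along a tangent vector, computed in the
  chart \<open>c\<close>.\<close>

definition deriv_along ::
  "('e, 'n::finite, 'm::finite) chart \<Rightarrow> 'e \<Rightarrow> ('e, 'n, 'm) tangent \<Rightarrow>
     ('e \<Rightarrow> 'b::real_normed_vector) \<Rightarrow> 'b" where
  "deriv_along c p v f = frechet_derivative (f \<circ> coord_inv c) (at (coord c p)) (v c)"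


section \<open>Linear connections\<close>

text \<open>\<open>nabla p v Y\<close> is the covariant derivative at \<open>p\<close>, along \<open>v \<in> T\<^sub>pE\<close>, of a vector field
  \<open>Y\<close> defined near \<open>p\<close>; thus \<open>nabla p (X p) Y\<close> is \<open>(\<nabla>\<^sub>X Y)(p)\<close>.\<close>

type_synonym ('e, 'n, 'm) cov_deriv =
  "'e \<Rightarrow> ('e, 'n, 'm) tangent \<Rightarrow> ('e \<Rightarrow> ('e, 'n, 'm) tangent) \<Rightarrow> ('e, 'n, 'm) tangent"

definition linear_connection ::
  "('e::topological_space, 'n::finite, 'm::finite) chart set \<Rightarrow> ('e, 'n, 'm) cov_deriv \<Rightarrow> bool" where
  "linear_connection A nabla \<longleftrightarrow>
     \<comment> \<open>smoothness; in particular values at \<open>p\<close> lie in \<open>T\<^sub>pE\<close>\<close>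
     (\<forall>W X Y. open W \<and> vector_field A W X \<and> vector_field A W Y \<longrightarrow>
        vector_field A W (\<lambda>p. nabla p (X p) Y)) \<and>
     \<comment> \<open>locality\<close>
     (\<forall>W p v Y Z. open W \<and> p \<in> W \<and> v \<in> tangent_space A p \<and>
        vector_field A W Y \<and> vector_field A W Z \<and> (\<forall>q\<in>W. Y q = Z q) \<longrightarrow>
        nabla p v Y = nabla p v Z) \<and>
     \<comment> \<open>linearity in the direction\<close>
     (\<forall>W p v w a b Y. open W \<and> p \<in> W \<and> v \<in> tangent_space A p \<and> w \<in> tangent_space A p \<and>
        vector_field A W Y \<longrightarrow>
        nabla p (\<lambda>d. a *\<^sub>R v d + b *\<^sub>R w d) Y = (\<lambda>d. a *\<^sub>R nabla p v Y d + b *\<^sub>R nabla p w Y d)) \<and>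
     \<comment> \<open>additivity\<close>
     (\<forall>W p v Y Z. open W \<and> p \<in> W \<and> v \<in> tangent_space A p \<and>
        vector_field A W Y \<and> vector_field A W Z \<longrightarrow>
        nabla p v (\<lambda>q d. Y q d + Z q d) = (\<lambda>d. nabla p v Y d + nabla p v Z d)) \<and>
     \<comment> \<open>Leibniz rule; the derivative of \<open>f\<close> along \<open>v\<close> may be computed in any chart \<open>c\<close> around \<open>p\<close>\<close>
     (\<forall>W p v f Y. open W \<and> p \<in> W \<and> v \<in> tangent_space A p \<and>
        smooth_function A W f \<and> vector_field A W Y \<longrightarrow>
        (\<forall>c\<in>A. p \<in> dom_of c \<longrightarrow>
           nabla p v (\<lambda>q d. f q *\<^sub>R Y q d) =
           (\<lambda>d. deriv_along c p v f *\<^sub>R Y p d + f p *\<^sub>R nabla p v Y d)))"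

text \<open>In the chart \<open>c\<close> the bracket \<open>[X, Y]\<close> has components \<open>X(Y\<^sup>C) - Y(X\<^sup>C)\<close>.\<close>

definition lie_bracket ::
  "('e \<Rightarrow> ('e, 'n::finite, 'm::finite) tangent) \<Rightarrow> ('e \<Rightarrow> ('e, 'n, 'm) tangent) \<Rightarrow>
     'e \<Rightarrow> ('e, 'n, 'm) tangent" where
  "lie_bracket X Y p c =
     deriv_along c p (X p) (\<lambda>q. Y q c) - deriv_along c p (Y p) (\<lambda>q. X q c)"

definition torsion_free ::
  "('e::topological_space, 'n::finite, 'm::finite) chart set \<Rightarrow> ('e, 'n, 'm) cov_deriv \<Rightarrow> bool" where
  "torsion_free A nabla \<longleftrightarrow>
     (\<forall>W X Y. open W \<and> vector_field A W X \<and> vector_field A W Y \<longrightarrow>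
        (\<forall>p\<in>W. \<forall>c\<in>A. p \<in> dom_of c \<longrightarrow>
           nabla p (X p) Y c - nabla p (Y p) X c = lie_bracket X Y p c))"

text \<open>\<open>christoffel A nabla c p a C b\<close> is \<open>\<Gamma>\<^sub>a\<^sup>C\<^sub>b\<close> at \<open>p\<close>, in the order of indices of
  \<open>\<nabla>\<^bsub>\<partial>a\<^esub> \<partial>\<^sub>b = \<Gamma>\<^sub>a\<^sup>C\<^sub>b \<partial>\<^sub>C\<close>: the middle argument is the upper index.\<close>

definition christoffel ::
  "('e, 'n::finite, 'm::finite) chart set \<Rightarrow> ('e, 'n, 'm) cov_deriv \<Rightarrow> ('e, 'n, 'm) chart \<Rightarrow> 'e \<Rightarrow>
     'n + 'm \<Rightarrow> 'n + 'm \<Rightarrow> 'n + 'm \<Rightarrow> real" where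
  "christoffel A nabla c p a C b = nabla p (coord_field A c a p) (coord_field A c b) c $ C"


section \<open>Submanifolds and their second-order jets\<close>

definition slice_chart ::
  "('e, 'n::finite, 'm::finite) chart set \<Rightarrow> 'e set \<Rightarrow> ('e, 'n, 'm) chart \<Rightarrow> bool" where
  "slice_chart A L c \<longleftrightarrow>
     c \<in> A \<and> L \<inter> dom_of c = {q \<in> dom_of c. \<forall>i. coord c q $ Inr i = 0}"

definition submanifold :: "('e, 'n::finite, 'm::finite) chart set \<Rightarrow> 'e set \<Rightarrow> bool" where
  "submanifold A L \<longleftrightarrow> (\<forall>p\<in>L. \<exists>c. slice_chart A L c \<and> p \<in> dom_of c)"

definition submanifold_tangent_space ::
  "('e, 'n::finite, 'm::finite) chart set \<Rightarrow> 'e set \<Rightarrow> 'e \<Rightarrow> ('e, 'n, 'm) tangent set" where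
  "submanifold_tangent_space A L p =
     {v \<in> tangent_space A p. \<exists>c. slice_chart A L c \<and> p \<in> dom_of c \<and> (\<forall>i. v c $ Inr i = 0)}"

definition join :: "real ^ 'n \<Rightarrow> real ^ 'm \<Rightarrow> real ^ ('n::finite + 'm::finite)" where
  "join x y = (\<chi> B. case B of Inl l \<Rightarrow> x $ l | Inr i \<Rightarrow> y $ i)"

definition partial_deriv ::
  "'n::finite \<Rightarrow> (real ^ 'n \<Rightarrow> 'b::real_normed_vector) \<Rightarrow> real ^ 'n \<Rightarrow> 'b" where
  "partial_deriv l f x = frechet_derivative f (at x) (axis l 1)"

text \<open>\<open>jet_coords c L p u1 u2\<close>: in the chart \<open>c\<close>, near \<open>p\<close>, the set \<open>L\<close> is the graph of a smooth
  map, \<open>u\<^sup>i = f\<^sup>i(u\<^sup>1, ..., u\<^sup>n)\<close>, and \<open>u1 i \<lambda>\<close>, \<open>u2 i \<lambda> \<xi>\<close> are the derivative coordinates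
  \<open>u\<^sup>i\<^sub>\<lambda>\<close>, \<open>u\<^sup>i\<^sub>\<lambda>\<^sub>\<xi>\<close> of \<open>L\<close> at \<open>p\<close>.\<close>

definition jet_coords ::
  "('e::topological_space, 'n::finite, 'm::finite) chart \<Rightarrow> 'e set \<Rightarrow> 'e \<Rightarrow>
     ('m \<Rightarrow> 'n \<Rightarrow> real) \<Rightarrow> ('m \<Rightarrow> 'n \<Rightarrow> 'n \<Rightarrow> real) \<Rightarrow> bool" where
  "jet_coords c L p u1 u2 \<longleftrightarrow>
     (\<exists>W V (f :: real ^ 'n \<Rightarrow> real ^ 'm).
        open W \<and> p \<in> L \<inter> W \<and> W \<subseteq> dom_of c \<and> open V \<and> smooth_on f V \<and>
        coord c ` (L \<inter> W) = (\<lambda>x. join x (f x)) ` V \<and>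
        (let x0 = (\<chi> l. coord c p $ Inl l) in
           (\<forall>i l. u1 i l = partial_deriv l f x0 $ i) \<and>
           (\<forall>i l x. u2 i l x = partial_deriv x (partial_deriv l f) x0 $ i)))"

text \<open>\<open>L\<close> and \<open>L'\<close> have a contact of order two at \<open>p\<close> iff they have the same second-order jet
  coordinates in every chart around \<open>p\<close> (in a chart in which one of them is not a graph, neither is
  the other).\<close>

definition contact2 ::
  "('e::topological_space, 'n::finite, 'm::finite) chart set \<Rightarrow> (('e set \<times> 'e) \<times> ('e set \<times> 'e)) set" where
  "contact2 A = {((L, p), (L', p')).
     submanifold A L \<and> submanifold A L' \<and> p = p' \<and> p \<in> L \<and> p \<in> L' \<and>
     (\<forall>c\<in>A. p \<in> dom_of c \<longrightarrow> (\<forall>u1 u2. jet_coords c L p u1 u2 \<longleftrightarrow> jet_coords c L' p u1 u2))}"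

text \<open>The second-order contact class \<open>[L]\<^sup>2\<^sub>p\<close>, and the space \<open>J\<^sup>2(E, n)\<close> of all of them.\<close>

definition contact_class ::
  "('e::topological_space, 'n::finite, 'm::finite) chart set \<Rightarrow> 'e set \<Rightarrow> 'e \<Rightarrow> ('e set \<times> 'e) set" where
  "contact_class A L p = contact2 A `` {(L, p)}"

definition J2 ::
  "('e::topological_space, 'n::finite, 'm::finite) chart set \<Rightarrow> ('e set \<times> 'e) set set" where
  "J2 A = {contact_class A L p | L p. submanifold A L \<and> p \<in> L}"


section \<open>Totally geodesic submanifolds and Grassmannian equivalence\<close>

text \<open>\<open>\<nabla>\<^sub>X Y mod T\<^sub>pL\<close> is zero at \<open>p\<close> for all \<open>X\<close>, \<open>Y\<close> tangent to \<open>L\<close>, each of them extended to a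
  vector field on a neighbourhood of \<open>p\<close> in \<open>E\<close>.\<close>

definition second_fundamental_form_vanishes ::
  "('e::topological_space, 'n::finite, 'm::finite) chart set \<Rightarrow> ('e, 'n, 'm) cov_deriv \<Rightarrow>
     'e set \<Rightarrow> 'e \<Rightarrow> bool" where
  "second_fundamental_form_vanishes A nabla L p \<longleftrightarrow>
     (\<forall>W X Y. open W \<and> p \<in> W \<and> vector_field A W X \<and> vector_field A W Y \<and>
        (\<forall>q \<in> L \<inter> W. X q \<in> submanifold_tangent_space A L q \<and>
                     Y q \<in> submanifold_tangent_space A L q) \<longrightarrow>
        nabla p (X p) Y \<in> submanifold_tangent_space A L p)"

definition totally_geodesic_equation ::
  "('e::topological_space, 'n::finite, 'm::finite) chart set \<Rightarrow> ('e, 'n, 'm) cov_deriv \<Rightarrow>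
     ('e set \<times> 'e) set set" where
  "totally_geodesic_equation A nabla =
     {\<theta> \<in> J2 A. \<exists>L p. submanifold A L \<and> p \<in> L \<and> \<theta> = contact_class A L p \<and>
        second_fundamental_form_vanishes A nabla L p}"

definition grassmannian_equivalent ::
  "('e::topological_space, 'n::finite, 'm::finite) chart set \<Rightarrow> ('e, 'n, 'm) cov_deriv \<Rightarrow>
     ('e, 'n, 'm) cov_deriv \<Rightarrow> bool" where
  "grassmannian_equivalent A nabla nabla' \<longleftrightarrow>
     totally_geodesic_equation A nabla = totally_geodesic_equation A nabla'"


section \<open>The quantities\<close>

definition delta :: "'a \<Rightarrow> 'a \<Rightarrow> real" where
  "delta a b = (if a = b then 1 else 0)"

text \<open>For an array \<open>G\<close> of Christoffel symbols at a point, these are the coefficients of the local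
  equation of totally geodesic submanifolds as a polynomial in the \<open>u\<^sup>i\<^sub>\<beta>\<close>: respectively the constant
  term and the coefficients of \<open>u\<^sup>i\<^sub>\<beta>\<close>, of \<open>u\<^sup>j\<^sub>\<alpha> u\<^sup>i\<^sub>\<beta>\<close>, and (up to sign) of
  \<open>u\<^sup>k\<^sub>\<beta> u\<^sup>j\<^sub>\<lambda> u\<^sup>i\<^sub>\<xi>\<close>.\<close>

definition quantity0 :: "('n + 'm \<Rightarrow> 'n + 'm \<Rightarrow> 'n + 'm \<Rightarrow> real) \<Rightarrow> 'n \<Rightarrow> 'n \<Rightarrow> 'm \<Rightarrow> real" where
  "quantity0 G l x k = G (Inl l) (Inr k) (Inl x)"

definition quantity1 ::
  "('n + 'm \<Rightarrow> 'n + 'm \<Rightarrow> 'n + 'm \<Rightarrow> real) \<Rightarrow> 'n \<Rightarrow> 'n \<Rightarrow> 'n \<Rightarrow> 'm \<Rightarrow> 'm \<Rightarrow> real" where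
  "quantity1 G l x b k i =
     delta b x * G (Inl l) (Inr k) (Inr i) + delta b l * G (Inr i) (Inr k) (Inl x)
     - delta k i * G (Inl l) (Inl b) (Inl x)"

definition quantity2 ::
  "('n + 'm \<Rightarrow> 'n + 'm \<Rightarrow> 'n + 'm \<Rightarrow> real) \<Rightarrow> 'n \<Rightarrow> 'n \<Rightarrow> 'n \<Rightarrow> 'n \<Rightarrow> 'm \<Rightarrow> 'm \<Rightarrow> 'm \<Rightarrow> real" where
  "quantity2 G l x a b k j i =
     delta a l * delta b x * G (Inr j) (Inr k) (Inr i)
     - delta a x * delta k i * G (Inl l) (Inl b) (Inr j)
     - delta a l * delta k i * G (Inr j) (Inl b) (Inl x)"

text \<open>Since \<open>u\<^sup>j\<^sub>\<alpha> u\<^sup>i\<^sub>\<beta> = u\<^sup>i\<^sub>\<beta> u\<^sup>j\<^sub>\<alpha>\<close>, the array \<open>quantity2\<close> of coefficients of a quadratic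
  form is determined by that form only up to terms antisymmetric under exchange of the pairs
  \<open>(\<alpha>, j)\<close> and \<open>(\<beta>, i)\<close>; such terms do change under a projective change
  \<open>\<Gamma>\<^sub>a\<^sup>C\<^sub>b \<mapsto> \<Gamma>\<^sub>a\<^sup>C\<^sub>b + \<delta>\<^sup>C\<^sub>a \<phi>\<^sub>b + \<delta>\<^sup>C\<^sub>b \<phi>\<^sub>a\<close>, except if \<open>n = m = 1\<close>.  The
  coefficient that is invariant is the symmetrized one.\<close>

definition quantity2_sym ::
  "('n + 'm \<Rightarrow> 'n + 'm \<Rightarrow> 'n + 'm \<Rightarrow> real) \<Rightarrow> 'n \<Rightarrow> 'n \<Rightarrow> 'n \<Rightarrow> 'n \<Rightarrow> 'm \<Rightarrow> 'm \<Rightarrow> 'm \<Rightarrow> real" where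
  "quantity2_sym G l x a b k j i =
     (quantity2 G l x a b k j i + quantity2 G l x b a k i j) / 2"

definition quantity3 :: "('n + 'm \<Rightarrow> 'n + 'm \<Rightarrow> 'n + 'm \<Rightarrow> real) \<Rightarrow> 'n \<Rightarrow> 'm \<Rightarrow> 'm \<Rightarrow> real" where
  "quantity3 G b j i = G (Inr j) (Inl b) (Inr i)"

end

theory Submission
  imports Defs
begin

text \<open>
  At a point near which a submanifold is a graph \<open>u\<^sup>i = f\<^sup>i(u\<^sup>1, \<dots>, u\<^sup>n)\<close> in the chart \<open>c\<close>, the
  second fundamental form vanishes iff the derivatives of \<open>f\<close> satisfy
  \<open>u\<^sup>k\<^sub>x\<^sub>l + P\<^sup>k\<^sub>l\<^sub>x(u) = 0\<close>, where \<open>P\<close> is a cubic polynomial in the first derivatives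
  \<open>u\<^sup>i\<^sub>b\<close> whose coefficients are built linearly from the Christoffel symbols
  (\<open>totally_geodesic_local_equation\<close>; the polynomial is \<open>normal_part\<close>). The proof of this equation passes
  to the chart in which the graph is a slice. There the second fundamental form is a block of
  Christoffel symbols, and these are carried back to \<open>c\<close> by the coordinate formula for \<open>\<nabla>\<close>.

  The equation expresses the second derivatives through the first. Given arbitrary first derivatives
  \<open>u\<close> at \<open>p\<close>, the graph of a quadratic polynomial realizes the jet with second derivatives
  \<open>- P(u)\<close>, which are symmetric because the connection has no torsion. Its contact class lies in the
  equation of \<open>\<nabla>\<close>, hence in that of any equivalent connection \<open>\<nabla>'\<close>, so \<open>- P(u) + P'(u) = 0\<close>
  (\<open>grassmannian_equivalent_normal_part\<close>). The two polynomials thus agree at every matrix \<open>u\<close>, and comparing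
  coefficients gives the invariants (\<open>normal_part_zero_imp_quantities_zero\<close>, applied to the difference of
  the Christoffel symbols). Since only the polynomial functions are compared, the quadratic
  coefficients are recovered up to antisymmetric terms, whence the symmetrization in
  \<open>quantity2_sym\<close>.
\<close>

section \<open>Calculus of smooth functions on open sets\<close>

text \<open>Openness of \<open>S\<close> is essential: \<open>Ck_on\<close> differentiates in the ambient space, so it sees the values
  of a function near the points of \<open>S\<close> and not only at these points.\<close>

lemma Ck_on_cong_open:
  assumes "open S" "\<And>x. x \<in> S \<Longrightarrow> f x = g x" "Ck_on k f S"
  shows "Ck_on k g S"
  using assms(2,3)
proof (induction k arbitrary: f g)
  case 0
  have "continuous_on S f = continuous_on S g"
    by (rule continuous_on_cong) (auto simp: 0(1))
  then show ?case using 0(2) by simp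
next
  case (Suc k)
  have df: "f differentiable (at x)" if "x \<in> S" for x
    using Suc.prems(2) that by simp
  have d: "(g has_derivative frechet_derivative f (at x)) (at x)" if x: "x \<in> S" for x
    by (rule has_derivative_transform_within_open[OF _ assms(1) x Suc.prems(1)])
      (use df[OF x] in \<open>simp_all add: frechet_derivative_works\<close>)
  have "Ck_on k (\<lambda>x. frechet_derivative g (at x) v) S" for v
  proof (rule Suc.IH)
    show "Ck_on k (\<lambda>x. frechet_derivative f (at x) v) S" using Suc.prems(2) by simp
    show "frechet_derivative f (at x) v = frechet_derivative g (at x) v" if "x \<in> S" for x
      by (rule fun_cong[OF frechet_derivative_at[OF d[OF that]]])
  qed
  moreover have "g differentiable (at x)" if "x \<in> S" for x
    using d[OF that] by (rule differentiableI)
  ultimately show ?case by simp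
qed

lemma Ck_on_subset: "Ck_on k f S \<Longrightarrow> T \<subseteq> S \<Longrightarrow> Ck_on k f T"
  by (induction k arbitrary: f) (auto intro: continuous_on_subset)

lemma Ck_on_SucD: "Ck_on (Suc k) f S \<Longrightarrow> Ck_on k f S"
proof (induction k arbitrary: f)
  case 0
  then show ?case
    by (auto intro!: continuous_at_imp_continuous_on differentiable_imp_continuous_within)
next
  case (Suc k)
  show ?case using Suc.prems Suc.IH unfolding Ck_on.simps(2)[of "Suc k"] Ck_on.simps(2)[of k f] by blast
qed

lemma Ck_on_const: "Ck_on k (\<lambda>x. b) S"
  by (induction k arbitrary: b) auto

lemma Ck_on_bounded_linear:
  assumes "bounded_linear h"
  shows "Ck_on k h S"
proof (cases k)
  case 0
  then show ?thesis using assms by (simp add: linear_continuous_on)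
next
  case (Suc k')
  have "(h has_derivative h) (at x)" for x
    using assms by (rule bounded_linear_imp_has_derivative)
  then have "h differentiable (at x)" "frechet_derivative h (at x) = h" for x
    by (auto intro: differentiableI frechet_derivative_at[symmetric])
  then show ?thesis using Suc by (simp add: Ck_on_const)
qed

lemma Ck_on_add:
  assumes "open S" "Ck_on k f S" "Ck_on k g S"
  shows "Ck_on k (\<lambda>x. f x + g x) S"
  using assms(2,3)
proof (induction k arbitrary: f g)
  case 0
  then show ?case by (simp add: continuous_on_add)
next
  case (Suc k)
  have d: "((\<lambda>x. f x + g x) has_derivative
      (\<lambda>v. frechet_derivative f (at x) v + frechet_derivative g (at x) v)) (at x)" if "x \<in> S" for x
    using Suc.prems that by (intro has_derivative_add) (auto simp: frechet_derivative_works)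
  have "Ck_on k (\<lambda>x. frechet_derivative f (at x) v + frechet_derivative g (at x) v) S" for v
    using Suc.prems by (intro Suc.IH) auto
  then have "Ck_on k (\<lambda>x. frechet_derivative (\<lambda>x. f x + g x) (at x) v) S" for v
    by (rule Ck_on_cong_open[OF assms(1), rotated]) (simp add: frechet_derivative_at[OF d, symmetric])
  then show ?case using d by (auto simp: differentiable_def)
qed

lemma Ck_on_scaleR:
  fixes a :: "'a::real_normed_vector \<Rightarrow> real"
  assumes "open S" "Ck_on k a S" "Ck_on k f S"
  shows "Ck_on k (\<lambda>x. a x *\<^sub>R f x) S"
  using assms(2,3)
proof (induction k arbitrary: a f)
  case 0
  then show ?case by (simp add: continuous_on_scaleR)
next
  case (Suc k)
  have d: "((\<lambda>x. a x *\<^sub>R f x) has_derivative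
      (\<lambda>v. a x *\<^sub>R frechet_derivative f (at x) v + frechet_derivative a (at x) v *\<^sub>R f x)) (at x)"
    if "x \<in> S" for x
    using Suc.prems that by (intro has_derivative_scaleR) (auto simp: frechet_derivative_works)
  have "Ck_on k (\<lambda>x. a x *\<^sub>R frechet_derivative f (at x) v
      + frechet_derivative a (at x) v *\<^sub>R f x) S" for v
    using Suc.prems Ck_on_SucD[OF Suc.prems(1)] Ck_on_SucD[OF Suc.prems(2)]
    by (intro Ck_on_add assms(1) Suc.IH) auto
  then have "Ck_on k (\<lambda>x. frechet_derivative (\<lambda>x. a x *\<^sub>R f x) (at x) v) S" for v
    by (rule Ck_on_cong_open[OF assms(1), rotated]) (simp add: frechet_derivative_at[OF d, symmetric])
  then show ?case using d by (auto simp: differentiable_def)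
qed

lemma Ck_on_sum:
  assumes "open S" "\<And>i. i \<in> I \<Longrightarrow> Ck_on k (f i) S"
  shows "Ck_on k (\<lambda>x. \<Sum>i\<in>I. f i x) S"
  using assms(2)
  by (induction I rule: infinite_finite_induct) (auto simp: Ck_on_const intro: Ck_on_add[OF assms(1)])

lemma Ck_on_linear_compose:
  assumes h: "bounded_linear h" and "open S" "Ck_on k f S"
  shows "Ck_on k (\<lambda>x. h (f x)) S"
  using assms(3)
proof (induction k arbitrary: f)
  case 0
  then show ?case by (simp add: bounded_linear.continuous_on[OF h])
next
  case (Suc k)
  have d: "((\<lambda>x. h (f x)) has_derivative (\<lambda>v. h (frechet_derivative f (at x) v))) (at x)"
    if "x \<in> S" for x
    using Suc.prems that by (intro bounded_linear.has_derivative[OF h]) (auto simp: frechet_derivative_works)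
  have "Ck_on k (\<lambda>x. h (frechet_derivative f (at x) v)) S" for v
    using Suc.prems by (intro Suc.IH) auto
  then have "Ck_on k (\<lambda>x. frechet_derivative (\<lambda>x. h (f x)) (at x) v) S" for v
    by (rule Ck_on_cong_open[OF assms(2), rotated]) (simp add: frechet_derivative_at[OF d, symmetric])
  then show ?case using d by (auto simp: differentiable_def)
qed

lemma frechet_derivative_chain:
  assumes "f differentiable (at x)" "g differentiable (at (f x))"
  shows "frechet_derivative (g \<circ> f) (at x) v = frechet_derivative g (at (f x)) (frechet_derivative f (at x) v)"
  by (rule fun_cong[OF frechet_derivative_compose[OF assms], simplified comp_apply[of "frechet_derivative g _"]])

lemma frechet_derivative_euclidean_expansion:
  fixes g :: "'b::euclidean_space \<Rightarrow> 'c::real_normed_vector"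
  assumes "g differentiable (at y)"
  shows "frechet_derivative g (at y) w = (\<Sum>b\<in>Basis. (w \<bullet> b) *\<^sub>R frechet_derivative g (at y) b)"
proof -
  have "linear (frechet_derivative g (at y))" using assms by (rule linear_frechet_derivative)
  then have "frechet_derivative g (at y) (\<Sum>b\<in>Basis. (w \<bullet> b) *\<^sub>R b)
      = (\<Sum>b\<in>Basis. (w \<bullet> b) *\<^sub>R frechet_derivative g (at y) b)"
    by (simp add: linear_sum linear_scale)
  then show ?thesis by (simp add: euclidean_representation)
qed

text \<open>The chain rule differentiates \<open>g \<circ> f\<close> in a direction that varies with the point, whereas
  \<open>Ck_on\<close> only speaks of derivatives in fixed directions. Expanding the moving direction
  \<open>f'(x) v\<close> in the finite basis of the intermediate space reduces the derivative to products of
  functions that are covered by the induction hypothesis.\<close>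

lemma Ck_on_compose:
  fixes f :: "'a::real_normed_vector \<Rightarrow> 'b::euclidean_space" and g :: "'b \<Rightarrow> 'c::real_normed_vector"
  assumes S: "open S" and fS: "f ` S \<subseteq> T" and "Ck_on k f S" "Ck_on k g T"
  shows "Ck_on k (g \<circ> f) S"
  using assms(3,4)
proof (induction k arbitrary: g)
  case 0
  then show ?case
    using continuous_on_compose[OF _ continuous_on_subset[OF _ fS]] by simp
next
  case (Suc k)
  have df: "f differentiable (at x)" and dg: "g differentiable (at (f x))" if "x \<in> S" for x
    using Suc.prems that fS by auto
  have d: "frechet_derivative (g \<circ> f) (at x) v
      = (\<Sum>b\<in>Basis. (frechet_derivative f (at x) v \<bullet> b) *\<^sub>R ((\<lambda>y. frechet_derivative g (at y) b) \<circ> f) x)"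
    if "x \<in> S" for x v
    unfolding comp_apply[of "\<lambda>y. frechet_derivative g (at y) _"]
    by (rule trans[OF frechet_derivative_chain[OF df dg, OF that that]
          frechet_derivative_euclidean_expansion[OF dg[OF that]]])
  have "Ck_on k ((\<lambda>y. frechet_derivative g (at y) b) \<circ> f) S" for b
    by (rule Suc.IH[OF Ck_on_SucD[OF Suc.prems(1)]]) (use Suc.prems(2) in simp)
  moreover have "Ck_on k (\<lambda>x. frechet_derivative f (at x) v \<bullet> b) S" for v b
    by (rule Ck_on_linear_compose[OF bounded_linear_inner_left S]) (use Suc.prems(1) in simp)
  ultimately have "Ck_on k (\<lambda>x. \<Sum>b\<in>Basis. (frechet_derivative f (at x) v \<bullet> b) *\<^sub>R
      ((\<lambda>y. frechet_derivative g (at y) b) \<circ> f) x) S" for v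
    by (intro Ck_on_sum Ck_on_scaleR S)
  then have "Ck_on k (\<lambda>x. frechet_derivative (g \<circ> f) (at x) v) S" for v
    by (rule Ck_on_cong_open[OF S, rotated]) (simp add: d)
  moreover have "(g \<circ> f) differentiable (at x)" if "x \<in> S" for x
    using df dg that by (metis differentiable_chain_at)
  ultimately show ?case unfolding Ck_on.simps by blast
qed

lemma smooth_on_cong_open:
  "open S \<Longrightarrow> (\<And>x. x \<in> S \<Longrightarrow> f x = g x) \<Longrightarrow> smooth_on f S \<Longrightarrow> smooth_on g S"
  unfolding smooth_on_def using Ck_on_cong_open by blast

lemma smooth_on_subset: "smooth_on f S \<Longrightarrow> T \<subseteq> S \<Longrightarrow> smooth_on f T"
  unfolding smooth_on_def using Ck_on_subset by blast

lemma smooth_on_const: "smooth_on (\<lambda>x. b) S"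
  by (simp add: smooth_on_def Ck_on_const)

lemma smooth_on_bounded_linear: "bounded_linear h \<Longrightarrow> smooth_on h S"
  by (simp add: smooth_on_def Ck_on_bounded_linear)

lemma smooth_on_add: "open S \<Longrightarrow> smooth_on f S \<Longrightarrow> smooth_on g S \<Longrightarrow> smooth_on (\<lambda>x. f x + g x) S"
  by (simp add: smooth_on_def Ck_on_add)

lemma smooth_on_sum:
  "open S \<Longrightarrow> (\<And>i. i \<in> I \<Longrightarrow> smooth_on (f i) S) \<Longrightarrow> smooth_on (\<lambda>x. \<Sum>i\<in>I. f i x) S"
  by (simp add: smooth_on_def Ck_on_sum)

lemma smooth_on_scaleR:
  "open S \<Longrightarrow> smooth_on a S \<Longrightarrow> smooth_on f S \<Longrightarrow> smooth_on (\<lambda>x. a x *\<^sub>R f x) S"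
  for a :: "_ \<Rightarrow> real"
  by (simp add: smooth_on_def Ck_on_scaleR)

lemma smooth_on_linear_compose:
  "bounded_linear h \<Longrightarrow> open S \<Longrightarrow> smooth_on f S \<Longrightarrow> smooth_on (\<lambda>x. h (f x)) S"
  by (simp add: smooth_on_def Ck_on_linear_compose)

lemma smooth_on_compose:
  fixes f :: "'a::real_normed_vector \<Rightarrow> 'b::euclidean_space"
  shows "open S \<Longrightarrow> f ` S \<subseteq> T \<Longrightarrow> smooth_on f S \<Longrightarrow> smooth_on g T \<Longrightarrow> smooth_on (g \<circ> f) S"
  unfolding smooth_on_def using Ck_on_compose by blast

lemma smooth_on_frechet_derivative:
  assumes "smooth_on f S"
  shows "smooth_on (\<lambda>x. frechet_derivative f (at x) v) S"
  unfolding smooth_on_def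
proof
  fix k
  have "Ck_on (Suc k) f S" using assms unfolding smooth_on_def ..
  then show "Ck_on k (\<lambda>x. frechet_derivative f (at x) v) S" by simp
qed

lemma smooth_on_differentiable:
  assumes "smooth_on f S" "x \<in> S"
  shows "f differentiable (at x)"
proof -
  have "Ck_on (Suc 0) f S" using assms(1) unfolding smooth_on_def ..
  then show ?thesis using assms(2) by simp
qed

lemma smooth_on_continuous_on:
  assumes "smooth_on f S"
  shows "continuous_on S f"
proof -
  have "Ck_on 0 f S" using assms unfolding smooth_on_def ..
  then show ?thesis by simp
qed

text \<open>The form in which tangency is used: a coordinate function that vanishes on a slice has zero
  derivative in the directions of the slice, whatever it does off the slice.\<close>

lemma frechet_derivative_zero_along_line:
  fixes g :: "'a::real_normed_vector \<Rightarrow> 'b::real_normed_vector"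
  assumes g: "g differentiable (at z)" and 0: "\<forall>\<^sub>F t in nhds (0::real). g (z + t *\<^sub>R v) = 0"
  shows "frechet_derivative g (at z) v = 0"
proof -
  have l: "((\<lambda>t. z + t *\<^sub>R v) has_derivative (\<lambda>t. t *\<^sub>R v)) (at (0::real))"
    by (auto intro!: derivative_eq_intros)
  have g': "(g has_derivative frechet_derivative g (at z)) (at (z + 0 *\<^sub>R v))"
    using g by (simp add: frechet_derivative_works)
  have "((\<lambda>t. g (z + t *\<^sub>R v)) has_derivative (\<lambda>t. frechet_derivative g (at z) (t *\<^sub>R v))) (at (0::real))"
    using diff_chain_at[OF l g'] by (simp add: comp_def)
  moreover obtain U where U: "open U" "0 \<in> U" "\<And>t. t \<in> U \<Longrightarrow> g (z + t *\<^sub>R v) = 0"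
    using 0 by (auto simp: eventually_nhds)
  have "((\<lambda>t. g (z + t *\<^sub>R v)) has_derivative (\<lambda>t. 0)) (at (0::real))"
    by (rule has_derivative_transform_within_open[OF has_derivative_const[of 0] U(1,2)]) (simp add: U(3))
  ultimately have "(\<lambda>t::real. frechet_derivative g (at z) (t *\<^sub>R v)) = (\<lambda>t. 0)"
    by (rule has_derivative_unique)
  then have "frechet_derivative g (at z) (1 *\<^sub>R v) = 0" by (rule fun_cong)
  then show ?thesis by simp
qed

section \<open>Changes of charts and tangent vectors\<close>

lemma is_chart_coord_inv:
  assumes "is_chart c" "q \<in> dom_of c"
  shows "coord_inv c (coord c q) = q"
  using assms by (simp add: is_chart_def homeomorphism_def)

lemma is_chart_coord:
  assumes "is_chart c" "x \<in> coord c ` dom_of c"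
  shows "coord c (coord_inv c x) = x" "coord_inv c x \<in> dom_of c"
  using assms by (auto simp: is_chart_def homeomorphism_def)

lemma is_chart_open_image:
  assumes c: "is_chart c" and "open W"
  shows "open (coord c ` (W \<inter> dom_of c))"
proof -
  have "coord c ` (W \<inter> dom_of c) = coord c ` dom_of c \<inter> coord_inv c -` W"
    using is_chart_coord_inv[OF c] is_chart_coord[OF c] by (auto simp: image_iff)
  moreover have "open (coord c ` dom_of c \<inter> coord_inv c -` W)"
    using c assms(2) by (intro continuous_open_preimage) (auto simp: is_chart_def homeomorphism_def)
  ultimately show ?thesis by simp
qed

lemma is_chart_open_preimage:
  assumes "is_chart c" "open U"
  shows "open (dom_of c \<inter> coord c -` U)"
  using assms by (intro continuous_open_preimage) (auto simp: is_chart_def homeomorphism_def)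

lemma transition_coord:
  assumes "is_chart c" "q \<in> dom_of c"
  shows "transition c d (coord c q) = coord d q"
  using is_chart_coord_inv[OF assms] by (simp add: transition_def)

abbreviation jacobian :: "('e, 'n::finite, 'm::finite) chart \<Rightarrow> ('e, 'n, 'm) chart \<Rightarrow> 'e \<Rightarrow>
    real ^ ('n + 'm) \<Rightarrow> real ^ ('n + 'm)" where
  "jacobian c d q \<equiv> frechet_derivative (transition c d) (at (coord c q))"

context
  fixes A :: "('e::{t2_space, second_countable_topology}, 'n::finite, 'm::finite) chart set"
  assumes M: "smooth_manifold A"
begin

lemma atlas_is_chart: "c \<in> A \<Longrightarrow> is_chart c"
  using M by (simp add: smooth_manifold_def)

lemma chart_open_dom: "c \<in> A \<Longrightarrow> open (dom_of c)"
  using atlas_is_chart by (auto simp: is_chart_def)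

lemmas coord_inv_coord = is_chart_coord_inv[OF atlas_is_chart]
lemmas coord_coord_inv = is_chart_coord[OF atlas_is_chart]

lemma open_coord_image: "c \<in> A \<Longrightarrow> open W \<Longrightarrow> open (coord c ` (W \<inter> dom_of c))"
  by (simp add: is_chart_open_image atlas_is_chart)

lemma smooth_transition:
  assumes "c \<in> A" "d \<in> A"
  shows "smooth_on (transition c d) (coord c ` (dom_of c \<inter> dom_of d))"
  using M assms by (simp add: smooth_manifold_def compatible_def)

lemma transition_differentiable:
  assumes "c \<in> A" "d \<in> A" "q \<in> dom_of c" "q \<in> dom_of d"
  shows "transition c d differentiable (at (coord c q))"
  by (rule smooth_on_differentiable[OF smooth_transition[OF assms(1,2)]]) (use assms in auto)

lemma linear_jacobian:
  assumes "c \<in> A" "d \<in> A" "q \<in> dom_of c" "q \<in> dom_of d"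
  shows "linear (jacobian c d q)"
  by (rule linear_frechet_derivative[OF transition_differentiable[OF assms]])

lemma jacobian_refl:
  assumes "c \<in> A" "q \<in> dom_of c"
  shows "jacobian c c q v = v"
proof -
  have "((\<lambda>x. x) has_derivative (\<lambda>x. x)) (at (coord c q))" by (rule has_derivative_ident)
  then have "(transition c c has_derivative (\<lambda>x. x)) (at (coord c q))"
    by (rule has_derivative_transform_within_open[OF _ open_coord_image[OF assms(1) open_UNIV]])
      (use assms coord_coord_inv in \<open>auto simp: transition_coord[OF atlas_is_chart]\<close>)
  then show ?thesis by (rule fun_cong[OF frechet_derivative_at[symmetric]])
qed

lemma jacobian_cocycle:
  assumes A: "c \<in> A" "d \<in> A" "e \<in> A" and q: "q \<in> dom_of c" "q \<in> dom_of d" "q \<in> dom_of e"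
  shows "jacobian c e q v = jacobian d e q (jacobian c d q v)"
proof -
  have cd: "transition c d (coord c q) = coord d q"
    by (rule transition_coord[OF atlas_is_chart[OF A(1)] q(1)])
  have "(transition c d has_derivative jacobian c d q) (at (coord c q))"
    using transition_differentiable[OF A(1,2) q(1,2)] by (simp add: frechet_derivative_works)
  moreover have "(transition d e has_derivative jacobian d e q) (at (transition c d (coord c q)))"
    unfolding cd using transition_differentiable[OF A(2,3) q(2,3)] by (simp add: frechet_derivative_works)
  ultimately have "(transition d e \<circ> transition c d has_derivative jacobian d e q \<circ> jacobian c d q) (at (coord c q))"
    by (rule diff_chain_at)
  then have "(transition c e has_derivative jacobian d e q \<circ> jacobian c d q) (at (coord c q))"
    by (rule has_derivative_transform_within_open[OF _ open_coord_image[OF A(1) chart_open_dom[OF A(2)]]])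
      (use q A in \<open>auto simp: transition_coord[OF atlas_is_chart]\<close>)
  then have "jacobian d e q \<circ> jacobian c d q = jacobian c e q"
    by (rule frechet_derivative_at)
  then have "(jacobian d e q \<circ> jacobian c d q) v = jacobian c e q v" by (rule fun_cong)
  then show ?thesis by simp
qed

lemma tangent_space_transform:
  assumes "v \<in> tangent_space A q" "c \<in> A" "d \<in> A" "q \<in> dom_of c" "q \<in> dom_of d"
  shows "v d = jacobian c d q (v c)"
  using assms unfolding tangent_space_def by blast

lemma tangent_space_outside:
  assumes "v \<in> tangent_space A q" "c \<notin> A \<or> q \<notin> dom_of c"
  shows "v c = 0"
  using assms unfolding tangent_space_def by blast

lemma tangent_spaceI:
  assumes "\<And>c d. c \<in> A \<Longrightarrow> d \<in> A \<Longrightarrow> q \<in> dom_of c \<Longrightarrow> q \<in> dom_of d \<Longrightarrow> v d = jacobian c d q (v c)"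
    and "\<And>c. c \<notin> A \<or> q \<notin> dom_of c \<Longrightarrow> v c = 0"
  shows "v \<in> tangent_space A q"
  using assms unfolding tangent_space_def by blast

lemma tangent_space_eqI:
  assumes "v \<in> tangent_space A q" "w \<in> tangent_space A q" "c \<in> A" "q \<in> dom_of c" "v c = w c"
  shows "v = w"
proof
  fix d
  show "v d = w d"
  proof (cases "d \<in> A \<and> q \<in> dom_of d")
    case True
    then show ?thesis
      using tangent_space_transform[OF assms(1,3) _ assms(4), of d]
        tangent_space_transform[OF assms(2,3) _ assms(4), of d] assms(5) by simp
  next
    case False
    then show ?thesis using tangent_space_outside[OF assms(1)] tangent_space_outside[OF assms(2)] by auto
  qed
qed

lemma tangent_space_add:
  assumes "v \<in> tangent_space A q" "w \<in> tangent_space A q"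
  shows "(\<lambda>d. a *\<^sub>R v d + b *\<^sub>R w d) \<in> tangent_space A q"
proof (rule tangent_spaceI)
  show "a *\<^sub>R v d + b *\<^sub>R w d = jacobian c d q (a *\<^sub>R v c + b *\<^sub>R w c)"
    if "c \<in> A" "d \<in> A" "q \<in> dom_of c" "q \<in> dom_of d" for c d
    unfolding linear_add[OF linear_jacobian[OF that]] linear_scale[OF linear_jacobian[OF that]]
      tangent_space_transform[OF assms(1) that] tangent_space_transform[OF assms(2) that] ..
qed (simp add: tangent_space_outside[OF assms(1)] tangent_space_outside[OF assms(2)])

lemma tangent_space_scale:
  assumes "v \<in> tangent_space A q"
  shows "(\<lambda>d. a *\<^sub>R v d) \<in> tangent_space A q"
  using tangent_space_add[OF assms assms, of a 0] by simp

lemma tangent_space_sum: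
  assumes "finite I" "\<And>i. i \<in> I \<Longrightarrow> v i \<in> tangent_space A q"
  shows "(\<lambda>d. \<Sum>i\<in>I. v i d) \<in> tangent_space A q"
  using assms
proof (induction I rule: finite_induct)
  case empty
  show ?case by (rule tangent_spaceI) (simp_all add: linear_0[OF linear_jacobian])
next
  case (insert i I)
  then show ?case
    using tangent_space_add[of "v i" q "\<lambda>d. \<Sum>i\<in>I. v i d" 1 1] by simp
qed

lemma coord_field_tangent:
  assumes c: "c \<in> A" "q \<in> dom_of c"
  shows "coord_field A c B q \<in> tangent_space A q"
proof (rule tangent_spaceI)
  fix d e assume d: "d \<in> A" "e \<in> A" "q \<in> dom_of d" "q \<in> dom_of e"
  show "coord_field A c B q e = jacobian d e q (coord_field A c B q d)"
    using jacobian_cocycle[OF c(1) d(1,2) c(2) d(3,4), of "axis B 1"] d by (simp add: coord_field_def)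
qed (auto simp: coord_field_def)

lemma coord_field_own_chart:
  "c \<in> A \<Longrightarrow> q \<in> dom_of c \<Longrightarrow> coord_field A c B q c = axis B 1"
  by (simp add: coord_field_def jacobian_refl)

text \<open>Smoothness need only be tested in one chart that covers \<open>W\<close>. This and the next two lemmas
  discharge the quantifier over all charts in the definitions of smooth functions and vector fields.\<close>

lemma smooth_on_change_chart:
  fixes g :: "'e \<Rightarrow> 'b::real_normed_vector"
  assumes c: "c \<in> A" and d: "d \<in> A" and W: "open W" "W \<subseteq> dom_of c"
    and g: "smooth_on (g \<circ> coord_inv c) (coord c ` W)"
  shows "smooth_on (g \<circ> coord_inv d) (coord d ` (W \<inter> dom_of d))"
proof -
  let ?S = "coord d ` (W \<inter> dom_of d)"
  have S: "open ?S" by (rule open_coord_image[OF d W(1)])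
  have "smooth_on (transition d c) ?S"
    by (rule smooth_on_subset[OF smooth_transition[OF d c]]) (use W in auto)
  moreover have "transition d c ` ?S \<subseteq> coord c ` W"
    using transition_coord[OF atlas_is_chart[OF d], of _ c] by auto
  ultimately have "smooth_on ((g \<circ> coord_inv c) \<circ> transition d c) ?S"
    by (intro smooth_on_compose[OF S _ _ g])
  then show ?thesis
    by (rule smooth_on_cong_open[OF S, rotated])
      (use W coord_inv_coord[OF c] coord_inv_coord[OF d] in \<open>auto simp: transition_def\<close>)
qed

lemma smooth_function_chart:
  assumes "c \<in> A" "open W" "W \<subseteq> dom_of c" "smooth_on (f \<circ> coord_inv c) (coord c ` W)"
  shows "smooth_function A W f"
  unfolding smooth_function_def using smooth_on_change_chart[OF assms(1) _ assms(2-4)] by blast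

lemma vector_field_chart:
  assumes c: "c \<in> A" and W: "open W" "W \<subseteq> dom_of c" 
    and X: "\<And>q. q \<in> W \<Longrightarrow> X q \<in> tangent_space A q"
    and s: "smooth_on (\<lambda>x. X (coord_inv c x) c) (coord c ` W)"
  shows "vector_field A W X"
  unfolding vector_field_def
proof (intro conjI ballI X)
  fix d assume d: "d \<in> A"
  let ?S = "coord d ` (W \<inter> dom_of d)"
  have S: "open ?S" by (rule open_coord_image[OF d W(1)])
  have "smooth_on ((\<lambda>q. X q c) \<circ> coord_inv c) (coord c ` W)" using s by (simp add: comp_def)
  then have 1: "smooth_on (\<lambda>x. X (coord_inv d x) c) ?S"
    using smooth_on_change_chart[OF c d W] by (fastforce simp: comp_def)
  have 2: "smooth_on (\<lambda>x. frechet_derivative (transition c d) (at (coord c (coord_inv d x))) b) ?S" for b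
  proof -
    have "smooth_on (\<lambda>x. frechet_derivative (transition c d) (at x) b) (coord c ` (W \<inter> dom_of d))"
      by (rule smooth_on_subset[OF smooth_on_frechet_derivative[OF smooth_transition[OF c d]]]) (use W in auto)
    moreover have "open (coord c ` (W \<inter> dom_of d))"
      using open_coord_image[OF c open_Int[OF W(1) chart_open_dom[OF d]]] W(2)
      by (simp add: inf.absorb1 le_infI1)
    moreover have "frechet_derivative (transition c d) (at x) b
        = ((\<lambda>q. frechet_derivative (transition c d) (at (coord c q)) b) \<circ> coord_inv c) x"
      if "x \<in> coord c ` (W \<inter> dom_of d)" for x
      using that W(2) coord_coord_inv(1)[OF c, of x] by auto
    ultimately have "smooth_on ((\<lambda>q. frechet_derivative (transition c d) (at (coord c q)) b) \<circ> coord_inv c)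
        (coord c ` (W \<inter> dom_of d))"
      by (rule smooth_on_cong_open[rotated 2])
    then have "smooth_on ((\<lambda>q. frechet_derivative (transition c d) (at (coord c q)) b) \<circ> coord_inv d)
        (coord d ` ((W \<inter> dom_of d) \<inter> dom_of d))"
      using W chart_open_dom[OF d] by (intro smooth_on_change_chart[OF c d]) auto
    then show ?thesis by (simp add: comp_def)
  qed
  have "smooth_on (\<lambda>x. \<Sum>b\<in>Basis. (X (coord_inv d x) c \<bullet> b) *\<^sub>R
      frechet_derivative (transition c d) (at (coord c (coord_inv d x))) b) ?S"
    by (intro smooth_on_sum smooth_on_scaleR S 2 smooth_on_linear_compose[OF bounded_linear_inner_left S 1])
  then show "smooth_on (\<lambda>x. X (coord_inv d x) d) ?S"
  proof (rule smooth_on_cong_open[OF S, rotated])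
    fix x assume "x \<in> ?S"
    then obtain q where q: "q \<in> W" "q \<in> dom_of d" "coord_inv d x = q"
      using coord_inv_coord[OF d] by auto
    then have qc: "q \<in> dom_of c" using W by auto
    show "(\<Sum>b\<in>Basis. (X (coord_inv d x) c \<bullet> b) *\<^sub>R
        frechet_derivative (transition c d) (at (coord c (coord_inv d x))) b) = X (coord_inv d x) d"
      unfolding q(3) tangent_space_transform[OF X[OF q(1)] c d qc q(2)]
      by (rule frechet_derivative_euclidean_expansion[OF transition_differentiable[OF c d qc q(2)], symmetric])
  qed
qed

lemma vector_field_subset: "vector_field A W X \<Longrightarrow> V \<subseteq> W \<Longrightarrow> vector_field A V X"
  unfolding vector_field_def by (meson Int_mono image_mono order_refl smooth_on_subset subsetD)

lemma vector_field_coord_field: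
  assumes "c \<in> A"
  shows "vector_field A (dom_of c) (coord_field A c B)"
proof (rule vector_field_chart[OF assms chart_open_dom[OF assms] order_refl])
  show "smooth_on (\<lambda>x. coord_field A c B (coord_inv c x) c) (coord c ` dom_of c)"
    using coord_coord_inv[OF assms] open_coord_image[OF assms open_UNIV]
    by (intro smooth_on_cong_open[OF _ _ smooth_on_const[of "axis B 1"]])
      (auto simp: coord_field_own_chart[OF assms])
qed (rule coord_field_tangent[OF assms])

text \<open>Maximality of the atlas is what makes adapted coordinates available: a chart followed by a
  diffeomorphism \<open>\<Psi>\<close> of its image (with inverse \<open>\<Phi>\<close>) is compatible with every chart, hence is itself
  a member of the atlas.\<close>

lemma chart_diffeo_in_atlas:
  assumes c: "c \<in> A" and U: "open U" "U \<subseteq> dom_of c"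
    and \<Psi>: "smooth_on \<Psi> (coord c ` U)" and open_image: "open (\<Psi> ` coord c ` U)"
    and \<Phi>: "smooth_on \<Phi> (\<Psi> ` coord c ` U)" and inv: "\<And>x. x \<in> coord c ` U \<Longrightarrow> \<Phi> (\<Psi> x) = x"
  shows "(U, \<Psi> \<circ> coord c) \<in> A" and "x \<in> \<Psi> ` coord c ` U \<Longrightarrow> coord_inv (U, \<Psi> \<circ> coord c) x = coord_inv c (\<Phi> x)"
proof -
  let ?e = "(U, \<Psi> \<circ> coord c)"
  let ?D = "coord c ` U"
  have D: "open ?D" using open_coord_image[OF c U(1)] U(2) by (simp add: inf.absorb1)
  have e: "dom_of ?e = U" "coord ?e = \<Psi> \<circ> coord c" "coord ?e ` U = \<Psi> ` ?D"
    by (auto simp: image_comp)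
  have cU: "coord_inv c (coord c q) = q" if "q \<in> U" for q
    using that U coord_inv_coord[OF c] by blast
  have inj: "inj_on (\<Psi> \<circ> coord c) U"
    by (rule inj_on_inverseI[where g = "\<lambda>x. coord_inv c (\<Phi> x)"]) (simp add: inv cU)
  have ei: "coord_inv ?e ((\<Psi> \<circ> coord c) q) = q" if "q \<in> U" for q
    unfolding coord_inv_def using inv_into_f_f[OF inj that] by simp
  have ei': "coord_inv ?e x = coord_inv c (\<Phi> x)" if x: "x \<in> \<Psi> ` ?D" for x
    using x ei inv cU by auto
  then show "x \<in> \<Psi> ` coord c ` U \<Longrightarrow> coord_inv ?e x = coord_inv c (\<Phi> x)" .
  have \<Phi>D: "\<Phi> ` \<Psi> ` ?D = ?D" using inv by (force simp: image_image)
  have "is_chart c" by (rule atlas_is_chart[OF c])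
  then have cc: "continuous_on (dom_of c) (coord c)" "continuous_on (coord c ` dom_of c) (coord_inv c)"
    by (auto simp: is_chart_def homeomorphism_def)
  have "is_chart ?e"
    unfolding is_chart_def e homeomorphism_def
  proof (intro conjI)
    show "open U" by (rule U)
    show "open ((\<Psi> \<circ> coord c) ` U)" using open_image by (simp add: image_comp)
    show "continuous_on U (\<Psi> \<circ> coord c)"
      by (intro continuous_on_compose continuous_on_subset[OF cc(1) U(2)] smooth_on_continuous_on[OF \<Psi>])
    have "continuous_on (\<Psi> ` ?D) (coord_inv c \<circ> \<Phi>)"
      by (intro continuous_on_compose smooth_on_continuous_on[OF \<Phi>] continuous_on_subset[OF cc(2)])
        (use \<Phi>D U in auto)
    then have "continuous_on (\<Psi> ` ?D) (coord_inv ?e)"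
      using continuous_on_cong[OF refl ei', of "\<Psi> ` ?D"] by (simp add: comp_def)
    then show "continuous_on ((\<Psi> \<circ> coord c) ` U) (coord_inv ?e)" by (simp add: image_comp)
  qed (use ei in \<open>auto simp: image_comp\<close>)
  moreover have "compatible ?e d" if d: "d \<in> A" for d
    unfolding compatible_def e
  proof
    have D': "open (coord c ` (U \<inter> dom_of d))"
    proof -
      have "U \<inter> dom_of d \<inter> dom_of c = U \<inter> dom_of d" using U by auto
      then show ?thesis using open_coord_image[OF c, of "U \<inter> dom_of d"] U chart_open_dom[OF d] by auto
    qed
    have sub: "coord c ` (U \<inter> dom_of d) \<subseteq> ?D" by auto
    have "(\<Psi> \<circ> coord c) ` (U \<inter> dom_of d) = \<Psi> ` ?D \<inter> \<Phi> -` (coord c ` (U \<inter> dom_of d))"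
    proof safe
      fix q q' assume "q' \<in> U" "\<Phi> (\<Psi> (coord c q')) = coord c q" "q \<in> U" "q \<in> dom_of d"
      then show "\<Psi> (coord c q') \<in> (\<Psi> \<circ> coord c) ` (U \<inter> dom_of d)" using inv by auto
    qed (use inv in auto)
    then have S: "open ((\<Psi> \<circ> coord c) ` (U \<inter> dom_of d))"
      using continuous_open_preimage[OF smooth_on_continuous_on[OF \<Phi>] open_image D'] by simp
    have "smooth_on (transition c d \<circ> \<Phi>) ((\<Psi> \<circ> coord c) ` (U \<inter> dom_of d))"
      by (rule smooth_on_compose[OF S _ smooth_on_subset[OF \<Phi>] smooth_transition[OF c d]])
        (use U inv in auto)
    then show "smooth_on (transition ?e d) ((\<Psi> \<circ> coord c) ` (U \<inter> dom_of d))"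
      by (rule smooth_on_cong_open[OF S, rotated]) (use ei' in \<open>auto simp: transition_def\<close>)
    have S': "open (coord d ` (U \<inter> dom_of d))" by (rule open_coord_image[OF d U(1)])
    have "smooth_on (\<Psi> \<circ> transition d c) (coord d ` (U \<inter> dom_of d))"
      by (rule smooth_on_compose[OF S' _ smooth_on_subset[OF smooth_transition[OF d c]] \<Psi>])
        (use U in \<open>auto simp: transition_coord[OF atlas_is_chart[OF d]]\<close>)
    then show "smooth_on (transition d ?e) (coord d ` (U \<inter> dom_of d))"
      by (rule smooth_on_cong_open[OF S', rotated]) (auto simp: transition_def)
  qed
  ultimately show "?e \<in> A" using M unfolding smooth_manifold_def by blast
qed

end

section \<open>Connections in coordinates\<close>

context
  fixes A :: "('e::{t2_space, second_countable_topology}, 'n::finite, 'm::finite) chart set"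
  assumes M: "smooth_manifold A"
begin

lemma vector_field_tangent: "vector_field A W X \<Longrightarrow> q \<in> W \<Longrightarrow> X q \<in> tangent_space A q"
  unfolding vector_field_def by blast

lemma vector_field_smooth:
  "vector_field A W X \<Longrightarrow> c \<in> A \<Longrightarrow> smooth_on (\<lambda>x. X (coord_inv c x) c) (coord c ` (W \<inter> dom_of c))"
  unfolding vector_field_def by blast

lemma tangent_space_coord_expansion:
  assumes c: "c \<in> A" and q: "q \<in> dom_of c" and v: "v \<in> tangent_space A q"
  shows "v = (\<lambda>d. \<Sum>B\<in>UNIV. v c $ B *\<^sub>R coord_field A c B q d)"
proof (rule tangent_space_eqI[OF M v _ c q])
  show "(\<lambda>d. \<Sum>B\<in>UNIV. v c $ B *\<^sub>R coord_field A c B q d) \<in> tangent_space A q"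
    by (intro tangent_space_sum[OF M] tangent_space_scale[OF M] coord_field_tangent[OF M c q]) auto
  show "v c = (\<Sum>B\<in>UNIV. v c $ B *\<^sub>R coord_field A c B q c)"
    by (simp add: coord_field_own_chart[OF M c q] vec_eq_iff axis_def if_distrib cong: if_cong)
qed

lemma vector_field_add:
  assumes c: "c \<in> A" and W: "open W" "W \<subseteq> dom_of c"
    and X: "vector_field A W X" and Y: "vector_field A W Y"
  shows "vector_field A W (\<lambda>q d. X q d + Y q d)"
proof (rule vector_field_chart[OF M c W])
  show "(\<lambda>d. X q d + Y q d) \<in> tangent_space A q" if "q \<in> W" for q
    using tangent_space_add[OF M vector_field_tangent[OF X that] vector_field_tangent[OF Y that], of 1 1]
    by simp
  have "W \<inter> dom_of c = W" "open (coord c ` (W \<inter> dom_of c))"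
    using W open_coord_image[OF M c W(1)] by auto
  then show "smooth_on (\<lambda>x. X (coord_inv c x) c + Y (coord_inv c x) c) (coord c ` W)"
    using smooth_on_add[OF _ vector_field_smooth[OF X c] vector_field_smooth[OF Y c]] by simp
qed

lemma vector_field_scale:
  assumes c: "c \<in> A" and W: "open W" "W \<subseteq> dom_of c"
    and f: "smooth_on (f \<circ> coord_inv c) (coord c ` W)" and X: "vector_field A W X"
  shows "vector_field A W (\<lambda>q d. f q *\<^sub>R X q d)"
proof (rule vector_field_chart[OF M c W])
  show "(\<lambda>d. f q *\<^sub>R X q d) \<in> tangent_space A q" if "q \<in> W" for q
    by (rule tangent_space_scale[OF M vector_field_tangent[OF X that]])
  have W': "W \<inter> dom_of c = W" "open (coord c ` (W \<inter> dom_of c))"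
    using W open_coord_image[OF M c W(1)] by auto
  show "smooth_on (\<lambda>x. f (coord_inv c x) *\<^sub>R X (coord_inv c x) c) (coord c ` W)"
    using smooth_on_scaleR[OF W'(2) _ vector_field_smooth[OF X c], of "f \<circ> coord_inv c"] f W'(1) by simp
qed

lemma vector_field_zero:
  assumes c: "c \<in> A" and W: "open W" "W \<subseteq> dom_of c"
  shows "vector_field A W (\<lambda>q d. 0)"
  by (rule vector_field_chart[OF M c W], rule tangent_spaceI[OF M])
    (simp_all add: smooth_on_const linear_0[OF linear_jacobian[OF M]])

lemma vector_field_sum:
  assumes c: "c \<in> A" and W: "open W" "W \<subseteq> dom_of c" and I: "finite I"
    and X: "\<And>i. i \<in> I \<Longrightarrow> vector_field A W (X i)"
  shows "vector_field A W (\<lambda>q d. \<Sum>i\<in>I. X i q d)"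
  using I X
proof (induction I rule: finite_induct)
  case empty
  show ?case using vector_field_zero[OF c W] by simp
next
  case (insert i I)
  then show ?case using vector_field_add[OF c W, of "X i" "\<lambda>q d. \<Sum>i\<in>I. X i q d"] by simp
qed

context
  fixes nabla :: "('e, 'n, 'm) cov_deriv"
  assumes conn: "linear_connection A nabla"
begin

lemma nabla_vector_field:
  "open W \<Longrightarrow> vector_field A W X \<Longrightarrow> vector_field A W Y \<Longrightarrow> vector_field A W (\<lambda>p. nabla p (X p) Y)"
  by (rule conn[unfolded linear_connection_def, THEN conjunct1, rule_format]) blast

lemma nabla_local:
  "open W \<Longrightarrow> p \<in> W \<Longrightarrow> v \<in> tangent_space A p \<Longrightarrow> vector_field A W Y \<Longrightarrow> vector_field A W Z \<Longrightarrow>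
    (\<And>q. q \<in> W \<Longrightarrow> Y q = Z q) \<Longrightarrow> nabla p v Y = nabla p v Z"
  by (rule conn[unfolded linear_connection_def, THEN conjunct2, THEN conjunct1, rule_format]) blast

lemma nabla_linear:
  "open W \<Longrightarrow> p \<in> W \<Longrightarrow> v \<in> tangent_space A p \<Longrightarrow> w \<in> tangent_space A p \<Longrightarrow> vector_field A W Y \<Longrightarrow>
    nabla p (\<lambda>d. a *\<^sub>R v d + b *\<^sub>R w d) Y = (\<lambda>d. a *\<^sub>R nabla p v Y d + b *\<^sub>R nabla p w Y d)"
  by (rule conn[unfolded linear_connection_def, THEN conjunct2, THEN conjunct2, THEN conjunct1, rule_format]) blast

lemma nabla_add:
  "open W \<Longrightarrow> p \<in> W \<Longrightarrow> v \<in> tangent_space A p \<Longrightarrow> vector_field A W Y \<Longrightarrow> vector_field A W Z \<Longrightarrow>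
    nabla p v (\<lambda>q d. Y q d + Z q d) = (\<lambda>d. nabla p v Y d + nabla p v Z d)"
  by (rule conn[unfolded linear_connection_def, THEN conjunct2, THEN conjunct2, THEN conjunct2, THEN conjunct1, rule_format]) blast

lemma nabla_leibniz:
  "open W \<Longrightarrow> p \<in> W \<Longrightarrow> v \<in> tangent_space A p \<Longrightarrow> smooth_function A W f \<Longrightarrow> vector_field A W Y \<Longrightarrow>
    c \<in> A \<Longrightarrow> p \<in> dom_of c \<Longrightarrow>
    nabla p v (\<lambda>q d. f q *\<^sub>R Y q d) = (\<lambda>d. deriv_along c p v f *\<^sub>R Y p d + f p *\<^sub>R nabla p v Y d)"
  by (rule conn[unfolded linear_connection_def, THEN conjunct2, THEN conjunct2, THEN conjunct2, THEN conjunct2, rule_format]) blast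

lemma nabla_sum_direction:
  assumes W: "open W" "p \<in> W" and Y: "vector_field A W Y"
    and I: "finite I" and v: "\<And>i. i \<in> I \<Longrightarrow> v i \<in> tangent_space A p"
  shows "nabla p (\<lambda>d. \<Sum>i\<in>I. a i *\<^sub>R v i d) Y = (\<lambda>d. \<Sum>i\<in>I. a i *\<^sub>R nabla p (v i) Y d)"
  using I v
proof (induction I rule: finite_induct)
  case empty
  have 0: "(\<lambda>d. 0) \<in> tangent_space A p"
    by (rule tangent_spaceI[OF M]) (simp_all add: linear_0[OF linear_jacobian[OF M]])
  show ?case using nabla_linear[OF W 0 0 Y, of 0 0] by simp
next
  case (insert i I)
  have "(\<lambda>d. \<Sum>i\<in>I. a i *\<^sub>R v i d) \<in> tangent_space A p"
    using insert by (intro tangent_space_sum[OF M] tangent_space_scale[OF M]) auto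
  from nabla_linear[OF W _ this Y, of "v i" "a i" 1] insert
  show ?case by simp
qed

lemma nabla_sum:
  assumes c: "c \<in> A" and W: "open W" "W \<subseteq> dom_of c" "p \<in> W" and v: "v \<in> tangent_space A p"
    and I: "finite I" and Y: "\<And>i. i \<in> I \<Longrightarrow> vector_field A W (Y i)"
  shows "nabla p v (\<lambda>q d. \<Sum>i\<in>I. Y i q d) = (\<lambda>d. \<Sum>i\<in>I. nabla p v (Y i) d)"
  using I Y
proof (induction I rule: finite_induct)
  case empty
  note 0 = vector_field_zero[OF c W(1,2)]
  have "nabla p v (\<lambda>q d. 0) = (\<lambda>d. nabla p v (\<lambda>q d. 0) d + nabla p v (\<lambda>q d. 0) d)"
    using nabla_add[OF W(1,3) v 0 0] by simp
  from fun_cong[OF this] have "nabla p v (\<lambda>q d. 0) d = 0" for d by simp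
  then show ?case by auto
next
  case (insert i I)
  then show ?case
    using nabla_add[OF W(1,3) v _ vector_field_sum[OF c W(1,2) insert(1)], of "Y i" Y] by simp
qed

text \<open>The coordinate formula \<open>(\<nabla>\<^sub>v Y)\<^sup>C = v(Y\<^sup>C) + v\<^sup>a Y\<^sup>b \<Gamma>\<^sub>a\<^sup>C\<^sub>b\<close>. By locality, \<open>Y\<close> may be replaced
  by \<open>Y\<^sup>B \<partial>\<^sub>B\<close>, where the coefficients \<open>Y\<^sup>B\<close> are smooth functions near \<open>p\<close>, and the axioms
  of a connection do the rest.\<close>

lemma nabla_in_chart:
  assumes c: "c \<in> A" "p \<in> dom_of c" and W: "open W" "p \<in> W"
    and v: "v \<in> tangent_space A p" and Y: "vector_field A W Y"
  shows "nabla p v Y c $ C = frechet_derivative (\<lambda>x. Y (coord_inv c x) c) (at (coord c p)) (v c) $ C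
    + (\<Sum>a\<in>UNIV. \<Sum>b\<in>UNIV. v c $ a * Y p c $ b * christoffel A nabla c p a C b)"
proof -
  let ?W = "W \<inter> dom_of c"
  let ?D = "frechet_derivative (\<lambda>x. Y (coord_inv c x) c) (at (coord c p)) (v c)"
  let ?E = "coord_field A c"
  have W': "open ?W" "?W \<subseteq> dom_of c" "p \<in> ?W" using W c chart_open_dom[OF M c(1)] by auto
  have Y': "vector_field A ?W Y" by (rule vector_field_subset[OF M Y]) auto
  have E: "vector_field A ?W (?E B)" for B
    by (rule vector_field_subset[OF M vector_field_coord_field[OF M c(1)]]) auto
  have D: "open (coord c ` ?W)" by (rule open_coord_image[OF M c(1) W(1)])
  have sY: "smooth_on (\<lambda>x. Y (coord_inv c x) c) (coord c ` ?W)"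
    by (rule vector_field_smooth[OF Y c(1)])
  have sB: "smooth_on ((\<lambda>q. Y q c $ B) \<circ> coord_inv c) (coord c ` ?W)" for B
    using smooth_on_linear_compose[OF bounded_linear_vec_nth[of B] D sY] by (simp add: comp_def)
  have dB: "deriv_along c p v (\<lambda>q. Y q c $ B) = ?D $ B" for B
  proof -
    have "((\<lambda>x. Y (coord_inv c x) c) has_derivative
        frechet_derivative (\<lambda>x. Y (coord_inv c x) c) (at (coord c p))) (at (coord c p))"
      using smooth_on_differentiable[OF sY, of "coord c p"] W c(2) by (simp add: frechet_derivative_works)
    from bounded_linear.has_derivative[OF bounded_linear_vec_nth[of B] this]
    show ?thesis unfolding deriv_along_def comp_def by (rule fun_cong[OF frechet_derivative_at[symmetric]])
  qed
  have sf: "smooth_function A ?W (\<lambda>q. Y q c $ B)" for B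
    by (rule smooth_function_chart[OF M c(1) W'(1,2) sB])
  have fld: "vector_field A ?W (\<lambda>q d. Y q c $ B *\<^sub>R ?E B q d)" for B
    by (rule vector_field_scale[OF c(1) W'(1,2) sB E])
  have "nabla p v Y = nabla p v (\<lambda>q d. \<Sum>B\<in>UNIV. Y q c $ B *\<^sub>R ?E B q d)"
  proof (rule nabla_local[OF W'(1,3) v Y' vector_field_sum[OF c(1) W'(1,2) _ fld]])
    show "Y q = (\<lambda>d. \<Sum>B\<in>UNIV. Y q c $ B *\<^sub>R ?E B q d)" if "q \<in> ?W" for q
      using that by (intro tangent_space_coord_expansion[OF c(1) _ vector_field_tangent[OF Y]]) auto
  qed simp
  also have "\<dots> = (\<lambda>d. \<Sum>B\<in>UNIV. ?D $ B *\<^sub>R ?E B p d + Y p c $ B *\<^sub>R nabla p v (?E B) d)"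
    using nabla_sum[OF c(1) W' v finite fld] nabla_leibniz[OF W'(1,3) v sf E c]
    by (simp add: dB)
  finally have 1: "nabla p v Y c = (\<Sum>B\<in>UNIV. ?D $ B *\<^sub>R axis B 1 + Y p c $ B *\<^sub>R nabla p v (?E B) c)"
    by (simp add: coord_field_own_chart[OF M c])
  have "nabla p v (?E B) c $ C = (\<Sum>a\<in>UNIV. v c $ a * christoffel A nabla c p a C B)" for B
  proof -
    have "nabla p v (?E B) = nabla p (\<lambda>d. \<Sum>a\<in>UNIV. v c $ a *\<^sub>R ?E a p d) (?E B)"
      using tangent_space_coord_expansion[OF c v] by simp
    also have "\<dots> = (\<lambda>d. \<Sum>a\<in>UNIV. v c $ a *\<^sub>R nabla p (?E a p) (?E B) d)"
      by (rule nabla_sum_direction[OF W'(1,3) E]) (auto intro: coord_field_tangent[OF M c])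
    finally show ?thesis by (simp add: christoffel_def)
  qed
  then have "nabla p v Y c $ C = (\<Sum>B\<in>UNIV. ?D $ B * axis B 1 $ C)
      + (\<Sum>B\<in>UNIV. Y p c $ B * (\<Sum>a\<in>UNIV. v c $ a * christoffel A nabla c p a C B))"
    unfolding 1 by (simp add: sum.distrib)
  also have "(\<Sum>B\<in>UNIV. ?D $ B * axis B 1 $ C) = ?D $ C"
    by (simp add: axis_def if_distrib cong: if_cong)
  also have "(\<Sum>B\<in>UNIV. Y p c $ B * (\<Sum>a\<in>UNIV. v c $ a * christoffel A nabla c p a C B))
      = (\<Sum>a\<in>UNIV. \<Sum>b\<in>UNIV. v c $ a * Y p c $ b * christoffel A nabla c p a C b)"
    unfolding sum_distrib_left by (subst sum.swap) (simp add: mult_ac)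
  finally show ?thesis .
qed

text \<open>Coordinate fields have constant components in their own chart, so their bracket is zero.\<close>

lemma christoffel_symmetric:
  assumes tf: "torsion_free A nabla" and c: "c \<in> A" "p \<in> dom_of c"
  shows "christoffel A nabla c p a C b = christoffel A nabla c p b C a"
proof -
  have "frechet_derivative ((\<lambda>q. coord_field A c B q c) \<circ> coord_inv c) (at (coord c p)) v = 0" for B v
  proof -
    have "((\<lambda>x. axis B 1) has_derivative (\<lambda>x. 0)) (at (coord c p))" by (rule has_derivative_const)
    then have "((\<lambda>q. coord_field A c B q c) \<circ> coord_inv c has_derivative (\<lambda>x. 0)) (at (coord c p))"
      by (rule has_derivative_transform_within_open[OF _ open_coord_image[OF M c(1) open_UNIV]])
        (use c coord_coord_inv[OF M c(1)] in \<open>auto simp: coord_field_own_chart[OF M c(1)]\<close>)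
    then show ?thesis by (rule fun_cong[OF frechet_derivative_at[symmetric]])
  qed
  then have "lie_bracket (coord_field A c a) (coord_field A c b) p c = 0"
    by (simp add: lie_bracket_def deriv_along_def)
  then have "nabla p (coord_field A c a p) (coord_field A c b) c
      - nabla p (coord_field A c b p) (coord_field A c a) c = 0"
    using tf c chart_open_dom[OF M c(1)] vector_field_coord_field[OF M c(1)]
    unfolding torsion_free_def by metis
  then show ?thesis by (simp add: christoffel_def)
qed

end
end

section \<open>The local equation of totally geodesic submanifolds\<close>

definition greek_part :: "real ^ ('n::finite + 'm::finite) \<Rightarrow> real ^ 'n" where
  "greek_part z = (\<chi> l. z $ Inl l)"

lemma greek_part_nth [simp]: "greek_part z $ l = z $ Inl l"
  by (simp add: greek_part_def)

lemma join_nth [simp]: "join x y $ Inl l = x $ l" "join x y $ Inr i = y $ i"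
  by (simp_all add: join_def)

lemma vec_eq_sum_iff:
  "z = w \<longleftrightarrow> (\<forall>l. z $ Inl l = w $ Inl l) \<and> (\<forall>i. z $ Inr i = w $ Inr i)"
  for z w :: "'b ^ ('n::finite + 'm::finite)"
  by (metis sumE vec_eq_iff)

lemma greek_part_join [simp]: "greek_part (join x y) = x"
  by (simp add: vec_eq_iff)

lemma greek_part_add [simp]: "greek_part (z + w) = greek_part z + greek_part w"
  by (simp add: vec_eq_iff)

lemma greek_part_diff [simp]: "greek_part (z - w) = greek_part z - greek_part w"
  by (simp add: vec_eq_iff)

lemma greek_part_axis [simp]: "greek_part (axis (Inl l) 1) = axis l 1"
  by (simp add: vec_eq_iff axis_def)

lemma bounded_linear_greek_part: "bounded_linear (greek_part :: real ^ ('n::finite + 'm::finite) \<Rightarrow> _)"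
  by (intro linear_conv_bounded_linear[THEN iffD1] linearI) (simp_all add: vec_eq_iff)

lemma bounded_linear_join_0: "bounded_linear (join (0 :: real ^ 'n::finite) :: real ^ 'm::finite \<Rightarrow> _)"
  by (intro linear_conv_bounded_linear[THEN iffD1] linearI) (simp_all add: vec_eq_sum_iff)

lemma frechet_derivative_partial_deriv:
  fixes f :: "real ^ 'n::finite \<Rightarrow> real ^ 'm::finite"
  assumes "f differentiable (at y)"
  shows "frechet_derivative f (at y) a $ k = (\<Sum>l\<in>UNIV. a $ l * partial_deriv l f y $ k)"
proof -
  have L: "linear (frechet_derivative f (at y))" using assms by (rule linear_frechet_derivative)
  have "a = (\<Sum>l\<in>UNIV. a $ l *\<^sub>R axis l 1)"
    by (simp add: vec_eq_iff axis_def if_distrib cong: if_cong)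
  then have "frechet_derivative f (at y) a = frechet_derivative f (at y) (\<Sum>l\<in>UNIV. a $ l *\<^sub>R axis l 1)"
    by simp
  also have "\<dots> = (\<Sum>l\<in>UNIV. a $ l *\<^sub>R partial_deriv l f y)"
    by (simp add: linear_sum[OF L] linear_scale[OF L] partial_deriv_def)
  finally show ?thesis by simp
qed

text \<open>If the submanifold is the graph \<open>u\<^sup>i = f\<^sup>i(u\<^sup>1, \<dots>, u\<^sup>n)\<close> with first derivatives \<open>u\<close>, then
  \<open>adapted_frame u l\<close> holds the components of its tangent vector \<open>\<partial>\<^sub>l + u\<^sup>j\<^sub>l \<partial>\<^sub>j\<close>.\<close>

definition adapted_frame :: "('m \<Rightarrow> 'n \<Rightarrow> real) \<Rightarrow> 'n \<Rightarrow> 'n + 'm \<Rightarrow> real" where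
  "adapted_frame u l B = (case B of Inl a \<Rightarrow> delta a l | Inr j \<Rightarrow> u j l)"

definition frame_contraction ::
  "('n::finite + 'm::finite \<Rightarrow> 'n + 'm \<Rightarrow> 'n + 'm \<Rightarrow> real) \<Rightarrow> ('m \<Rightarrow> 'n \<Rightarrow> real) \<Rightarrow> 'n + 'm \<Rightarrow> 'n \<Rightarrow> 'n \<Rightarrow> real"
  where "frame_contraction G u C l x =
    (\<Sum>a\<in>UNIV. \<Sum>b\<in>UNIV. adapted_frame u l a * adapted_frame u x b * G a C b)"

text \<open>The value of the bilinear map \<open>G\<close> on two vectors of the frame, taken modulo the plane spanned
  by the frame and identified by its Latin components: subtracting the combination of frame vectors
  with the same Greek components leaves \<open>w\<^sup>k - u\<^sup>k\<^sub>b w\<^sup>b\<close>. For Christoffel symbols this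
  is the part of the totally geodesic equation that does not involve second derivatives.\<close>

definition normal_part ::
  "('n::finite + 'm::finite \<Rightarrow> 'n + 'm \<Rightarrow> 'n + 'm \<Rightarrow> real) \<Rightarrow> ('m \<Rightarrow> 'n \<Rightarrow> real) \<Rightarrow> 'm \<Rightarrow> 'n \<Rightarrow> 'n \<Rightarrow> real"
  where "normal_part G u k l x =
    frame_contraction G u (Inr k) l x - (\<Sum>b\<in>UNIV. u k b * frame_contraction G u (Inl b) l x)"

context
  fixes A :: "('e::{t2_space, second_countable_topology}, 'n::finite, 'm::finite) chart set"
  assumes M: "smooth_manifold A"
begin

lemma slice_chart_latin_zero_iff:
  "slice_chart A L e \<Longrightarrow> q \<in> dom_of e \<Longrightarrow> q \<in> L \<longleftrightarrow> (\<forall>i. coord e q $ Inr i = 0)"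
  unfolding slice_chart_def by blast

text \<open>Tangency is defined through some slice chart; it can be tested in every slice chart, because the
  transition map between two slice charts sends slice to slice.\<close>

lemma submanifold_tangent_latin_zero:
  assumes v: "v \<in> submanifold_tangent_space A L q" and q: "q \<in> L"
    and e: "slice_chart A L e" "q \<in> dom_of e"
  shows "v e $ Inr i = 0"
proof -
  obtain d where d: "slice_chart A L d" "q \<in> dom_of d" "\<And>i. v d $ Inr i = 0"
    and vt: "v \<in> tangent_space A q"
    using v unfolding submanifold_tangent_space_def by blast
  have A: "d \<in> A" "e \<in> A" using d(1) e(1) by (auto simp: slice_chart_def)
  let ?z = "coord d q"
  let ?g = "\<lambda>x. transition d e x $ Inr i"
  have "(transition d e has_derivative jacobian d e q) (at ?z)"
    using transition_differentiable[OF M A d(2) e(2)] by (simp add: frechet_derivative_works)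
  then have g: "(?g has_derivative (\<lambda>w. jacobian d e q w $ Inr i)) (at ?z)"
    by (rule bounded_linear.has_derivative[OF bounded_linear_vec_nth])
  have N: "open (coord d ` (dom_of e \<inter> dom_of d))"
    by (rule open_coord_image[OF M A(1) chart_open_dom[OF M A(2)]])
  have "((\<lambda>t. ?z + t *\<^sub>R v d) \<longlongrightarrow> ?z + 0 *\<^sub>R v d) (nhds (0::real))"
    by (intro tendsto_intros filterlim_ident)
  then have "\<forall>\<^sub>F t in nhds (0::real). ?z + t *\<^sub>R v d \<in> coord d ` (dom_of e \<inter> dom_of d)"
    by (rule topological_tendstoD[OF _ N]) (use d(2) e(2) in auto)
  then have "\<forall>\<^sub>F t in nhds (0::real). ?g (?z + t *\<^sub>R v d) = 0"
  proof (rule eventually_mono)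
    fix t :: real assume "?z + t *\<^sub>R v d \<in> coord d ` (dom_of e \<inter> dom_of d)"
    then obtain r where r: "r \<in> dom_of e" "r \<in> dom_of d" "coord d r = ?z + t *\<^sub>R v d" by auto
    have "\<forall>i. coord d r $ Inr i = 0"
      using slice_chart_latin_zero_iff[OF d(1,2)] q d(3) unfolding r(3) by simp
    then have "r \<in> L" using slice_chart_latin_zero_iff[OF d(1) r(2)] by blast
    then have "coord e r $ Inr i = 0" using slice_chart_latin_zero_iff[OF e(1) r(1)] by blast
    then show "?g (?z + t *\<^sub>R v d) = 0"
      using transition_coord[OF atlas_is_chart[OF M A(1)] r(2), of e] r(3) by simp
  qed
  then have "frechet_derivative ?g (at ?z) (v d) = 0"
    by (rule frechet_derivative_zero_along_line[OF differentiableI[OF g]])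
  then have "jacobian d e q (v d) $ Inr i = 0"
    unfolding frechet_derivative_at[OF g, symmetric] .
  then show ?thesis unfolding tangent_space_transform[OF M vt A d(2) e(2)] .
qed

text \<open>In a slice chart, tangent fields have vanishing Latin components along \<open>L\<close>, so differentiating
  these components along \<open>L\<close> gives \<open>0\<close>, and only the Christoffel term of \<open>\<nabla>\<^sub>X Y\<close> can leave the
  tangent space. Conversely the Greek coordinate fields are tangent to \<open>L\<close> and detect each of these
  Christoffel symbols.\<close>

lemma second_fundamental_form_vanishes_slice:
  assumes conn: "linear_connection A nabla" and e: "slice_chart A L e" and p: "p \<in> L" "p \<in> dom_of e"
  shows "second_fundamental_form_vanishes A nabla L p \<longleftrightarrow>
    (\<forall>l x k. christoffel A nabla e p (Inl l) (Inr k) (Inl x) = 0)"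
proof
  have eA: "e \<in> A" using e by (simp add: slice_chart_def)
  note D = chart_open_dom[OF M eA]
  have F: "vector_field A (dom_of e) (coord_field A e B)" for B by (rule vector_field_coord_field[OF M eA])
  {
    assume S: "second_fundamental_form_vanishes A nabla L p"
    have "coord_field A e (Inl l) q \<in> submanifold_tangent_space A L q" if "q \<in> dom_of e" for q l
    proof -
      have "coord_field A e (Inl l) q e $ Inr i = 0" for i
        by (simp add: coord_field_own_chart[OF M eA that] axis_def)
      then show ?thesis
        unfolding submanifold_tangent_space_def using e that coord_field_tangent[OF M eA that] by blast
    qed
    then have "nabla p (coord_field A e (Inl l) p) (coord_field A e (Inl x)) \<in> submanifold_tangent_space A L p" for l x
      using S F[of "Inl l"] F[of "Inl x"] D p unfolding second_fundamental_form_vanishes_def by blast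
    from submanifold_tangent_latin_zero[OF this p(1) e p(2)]
    show "\<forall>l x k. christoffel A nabla e p (Inl l) (Inr k) (Inl x) = 0"
      by (simp add: christoffel_def)
  next
    assume \<Gamma>: "\<forall>l x k. christoffel A nabla e p (Inl l) (Inr k) (Inl x) = 0"
    show "second_fundamental_form_vanishes A nabla L p"
      unfolding second_fundamental_form_vanishes_def
    proof (intro allI impI, elim conjE)
      fix W X Y
      assume W: "open W" "p \<in> W" and X: "vector_field A W X" and Y: "vector_field A W Y"
        and t: "\<forall>q\<in>L \<inter> W. X q \<in> submanifold_tangent_space A L q \<and> Y q \<in> submanifold_tangent_space A L q"
      have tX: "X q e $ Inr i = 0" and tY: "Y q e $ Inr i = 0" if "q \<in> L" "q \<in> W" "q \<in> dom_of e" for q i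
        using submanifold_tangent_latin_zero[OF _ that(1) e that(3)] t that by auto
      let ?F = "\<lambda>x. Y (coord_inv e x) e"
      let ?z = "coord e p"
      have N: "open (coord e ` (W \<inter> dom_of e))" by (rule open_coord_image[OF M eA W(1)])
      have "nabla p (X p) Y e $ Inr k = 0" for k
      proof -
        let ?g = "\<lambda>x. ?F x $ Inr k"
        have "(?F has_derivative frechet_derivative ?F (at ?z)) (at ?z)"
          using smooth_on_differentiable[OF vector_field_smooth[OF M Y eA], of ?z] W p
          by (simp add: frechet_derivative_works)
        then have g: "(?g has_derivative (\<lambda>w. frechet_derivative ?F (at ?z) w $ Inr k)) (at ?z)"
          by (rule bounded_linear.has_derivative[OF bounded_linear_vec_nth])
        have "((\<lambda>t. ?z + t *\<^sub>R X p e) \<longlongrightarrow> ?z + 0 *\<^sub>R X p e) (nhds (0::real))"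
          by (intro tendsto_intros filterlim_ident)
        then have "\<forall>\<^sub>F t in nhds (0::real). ?z + t *\<^sub>R X p e \<in> coord e ` (W \<inter> dom_of e)"
          by (rule topological_tendstoD[OF _ N]) (use W p in auto)
        then have "\<forall>\<^sub>F t in nhds (0::real). ?g (?z + t *\<^sub>R X p e) = 0"
        proof (rule eventually_mono)
          fix t :: real assume "?z + t *\<^sub>R X p e \<in> coord e ` (W \<inter> dom_of e)"
          then obtain r where r: "r \<in> W" "r \<in> dom_of e" "coord e r = ?z + t *\<^sub>R X p e" by auto
          have "\<forall>i. coord e r $ Inr i = 0"
            using slice_chart_latin_zero_iff[OF e p(2)] p(1) tX[OF p(1) W(2) p(2)] unfolding r(3) by simp
          then have "r \<in> L" using slice_chart_latin_zero_iff[OF e r(2)] by blast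
          then show "?g (?z + t *\<^sub>R X p e) = 0"
            using tY[OF _ r(1,2)] coord_inv_coord[OF M eA r(2)] r(3) by simp
        qed
        then have "frechet_derivative ?g (at ?z) (X p e) = 0"
          by (rule frechet_derivative_zero_along_line[OF differentiableI[OF g]])
        then have 1: "frechet_derivative ?F (at ?z) (X p e) $ Inr k = 0"
          unfolding frechet_derivative_at[OF g, symmetric] .
        have "X p e $ a * Y p e $ b * christoffel A nabla e p a (Inr k) b = 0" for a b
          using tX[OF p(1) W(2) p(2)] tY[OF p(1) W(2) p(2)] \<Gamma> by (cases a; cases b) auto
        then have 2: "(\<Sum>a\<in>UNIV. \<Sum>b\<in>UNIV.
            X p e $ a * Y p e $ b * christoffel A nabla e p a (Inr k) b) = 0"
          by (intro sum.neutral ballI)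
        show ?thesis
          unfolding nabla_in_chart[OF M conn eA p(2) W vector_field_tangent[OF M X W(2)] Y] 1 2 by simp
      qed
      then show "nabla p (X p) Y \<in> submanifold_tangent_space A L p"
        unfolding submanifold_tangent_space_def
        using vector_field_tangent[OF M nabla_vector_field[OF M conn W(1) X Y] W(2)] e p(2) by blast
    qed
  }
qed

text \<open>Subtracting \<open>f\<close> from the Latin coordinates turns the graph of \<open>f\<close> into a slice. This
  provides slice charts whose relation to the given chart is explicit.\<close>

lemma graph_straightening_chart:
  fixes c :: "('e, 'n, 'm) chart" and f :: "real ^ 'n \<Rightarrow> real ^ 'm"
  assumes c: "c \<in> A" and W: "open W" "W \<subseteq> dom_of c" and V: "open V" and f: "smooth_on f V"
    and graph: "coord c ` (L \<inter> W) = (\<lambda>x. join x (f x)) ` V"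
  defines "e \<equiv> (W \<inter> (dom_of c \<inter> coord c -` (greek_part -` V)),
      (\<lambda>z. z - join 0 (f (greek_part z))) \<circ> coord c)"
  shows "slice_chart A L e" "L \<inter> W \<subseteq> dom_of e"
    and "x \<in> coord e ` dom_of e \<Longrightarrow> transition e c x = x + join 0 (f (greek_part x))"
proof -
  let ?\<Psi> = "\<lambda>z::real ^ ('n + 'm). z - join 0 (f (greek_part z))"
  let ?\<Phi> = "\<lambda>z::real ^ ('n + 'm). z + join 0 (f (greek_part z))"
  let ?C = "greek_part -` V :: (real ^ ('n + 'm)) set"
  let ?U = "dom_of e"
  have C: "open ?C"
    using continuous_open_vimage[OF V, of greek_part] linear_continuous_at[OF bounded_linear_greek_part] by blast
  have U: "open ?U" "?U \<subseteq> dom_of c" "coord c ` ?U \<subseteq> ?C"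
    unfolding e_def using W is_chart_open_preimage[OF atlas_is_chart[OF M c] C] by auto
  have jf: "smooth_on (\<lambda>z. join 0 (f (greek_part z))) ?C"
    using smooth_on_linear_compose[OF bounded_linear_join_0 C
        smooth_on_compose[OF C _ smooth_on_bounded_linear[OF bounded_linear_greek_part] f]]
    by (auto simp: comp_def)
  have \<Phi>: "smooth_on ?\<Phi> ?C"
    using smooth_on_add[OF C smooth_on_bounded_linear[OF bounded_linear_ident] jf] .
  have "smooth_on (\<lambda>z. - join 0 (f (greek_part z)) :: real ^ ('n + 'm)) ?C"
    by (rule smooth_on_linear_compose[OF bounded_linear_minus[OF bounded_linear_ident] C jf])
  from smooth_on_add[OF C smooth_on_bounded_linear[OF bounded_linear_ident] this]
  have \<Psi>: "smooth_on ?\<Psi> ?C" by simp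
  have inv: "?\<Phi> (?\<Psi> z) = z" "?\<Psi> (?\<Phi> z) = z" for z by simp_all
  have "?U \<inter> dom_of c = ?U" using U by auto
  then have D: "open (coord c ` ?U)" using open_coord_image[OF M c U(1)] by simp
  have "?\<Psi> ` coord c ` ?U = ?C \<inter> ?\<Phi> -` (coord c ` ?U)"
  proof (intro equalityI subsetI)
    fix z assume "z \<in> ?C \<inter> ?\<Phi> -` (coord c ` ?U)"
    then show "z \<in> ?\<Psi> ` coord c ` ?U" using inv(2)[of z] by (intro image_eqI[of _ _ "?\<Phi> z"]) auto
  qed (use U(3) inv(1) in \<open>auto simp: image_iff\<close>)
  then have D': "open (?\<Psi> ` coord c ` ?U)" "?\<Psi> ` coord c ` ?U \<subseteq> ?C"
    using continuous_open_preimage[OF smooth_on_continuous_on[OF \<Phi>] C D] by auto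
  have e: "e = (?U, ?\<Psi> \<circ> coord c)" by (simp add: e_def)
  note diffeo = chart_diffeo_in_atlas[OF M c U(1,2) smooth_on_subset[OF \<Psi> U(3)] D'(1)
      smooth_on_subset[OF \<Phi> D'(2)] inv(1), folded e]
  show LW: "L \<inter> W \<subseteq> ?U"
  proof
    fix q assume q: "q \<in> L \<inter> W"
    then have "coord c q \<in> (\<lambda>x. join x (f x)) ` V" using graph by blast
    then show "q \<in> ?U" using q W by (auto simp: e_def)
  qed
  have "q \<in> L \<longleftrightarrow> (\<forall>i. coord e q $ Inr i = 0)" if q: "q \<in> ?U" for q
  proof
    assume "q \<in> L"
    then have "coord c q \<in> (\<lambda>x. join x (f x)) ` V" using q graph by (auto simp: e_def)
    then show "\<forall>i. coord e q $ Inr i = 0" by (auto simp: e_def)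
  next
    assume "\<forall>i. coord e q $ Inr i = 0"
    then have "coord c q = join (greek_part (coord c q)) (f (greek_part (coord c q)))"
      by (simp add: vec_eq_sum_iff e_def)
    moreover have "greek_part (coord c q) \<in> V" using q by (auto simp: e_def)
    ultimately have "coord c q \<in> coord c ` (L \<inter> W)" using graph by blast
    then obtain r where r: "r \<in> L" "r \<in> W" "coord c q = coord c r" by blast
    then have "q = r" using coord_inv_coord[OF M c] q U(2) W(2) by (metis subsetD)
    then show "q \<in> L" using r by simp
  qed
  then show "slice_chart A L e"
    using diffeo(1) unfolding slice_chart_def by blast
  show "transition e c x = ?\<Phi> x" if x: "x \<in> coord e ` dom_of e"
  proof -
    have x': "x \<in> ?\<Psi> ` coord c ` ?U" using x by (auto simp: e_def)
    then have "?\<Phi> x \<in> coord c ` ?U" using inv(1) by (force simp del: greek_part_diff)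
    then have "coord c (coord_inv c (?\<Phi> x)) = ?\<Phi> x" using U(2) by (intro coord_coord_inv[OF M c]) auto
    then show ?thesis using diffeo(2)[OF x'] by (simp add: transition_def)
  qed
qed

text \<open>The local equation of totally geodesic submanifolds, for every submanifold that is a graph in
  the chart \<open>c\<close>. In the chart that straightens the graph, the second fundamental form consists of the
  Christoffel symbols \<open>\<Gamma>\<^sub>l\<^sup>k\<^sub>x\<close>. Transformed back to \<open>c\<close>, the Greek coordinate
  fields become \<open>\<partial>\<^sub>l + \<partial>\<^sub>l f\<^sup>j \<partial>\<^sub>j\<close>; the second derivatives of \<open>f\<close> come from differentiating
  these fields, and \<open>normal_part\<close> from the Christoffel symbols of \<open>c\<close>.\<close>

theorem totally_geodesic_local_equation:
  fixes nabla :: "('e, 'n, 'm) cov_deriv"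
  assumes conn: "linear_connection A nabla" and c: "c \<in> A" and jet: "jet_coords c L p u1 u2"
  shows "second_fundamental_form_vanishes A nabla L p \<longleftrightarrow>
    (\<forall>l x k. u2 k x l + normal_part (christoffel A nabla c p) u1 k l x = 0)"
proof -
  obtain W V and f :: "real ^ 'n \<Rightarrow> real ^ 'm" where
    W: "open W" "W \<subseteq> dom_of c" and p: "p \<in> L \<inter> W" and V: "open V" and f: "smooth_on f V"
    and graph: "coord c ` (L \<inter> W) = (\<lambda>x. join x (f x)) ` V"
    and u1: "\<And>i l. u1 i l = partial_deriv l f (greek_part (coord c p)) $ i"
    and u2: "\<And>i l x. u2 i l x = partial_deriv x (partial_deriv l f) (greek_part (coord c p)) $ i"
    using jet unfolding jet_coords_def Let_def greek_part_def by blast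
  define e where "e = (W \<inter> (dom_of c \<inter> coord c -` (greek_part -` V)),
      (\<lambda>z. z - join 0 (f (greek_part z))) \<circ> coord c)"
  note straight = graph_straightening_chart[OF c W V f graph, folded e_def]
  define z where "z = coord c p"
  define y where "y = greek_part z"
  have eA: "e \<in> A" using straight(1) by (simp add: slice_chart_def)
  have pe: "p \<in> dom_of e" and pc: "p \<in> dom_of c" using straight(2) p W by auto
  have e: "dom_of e \<subseteq> dom_of c" "\<And>q. q \<in> dom_of e \<Longrightarrow> greek_part (coord c q) \<in> V"
    "\<And>q. coord e q = coord c q - join 0 (f (greek_part (coord c q)))"
    by (auto simp: e_def)
  note D = chart_open_dom[OF M eA]
  have fd: "(f has_derivative frechet_derivative f (at x)) (at x)" if "x \<in> V" for x
    using smooth_on_differentiable[OF f that] by (simp add: frechet_derivative_works)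
  have gd: "(greek_part has_derivative greek_part) (at x)" for x :: "real ^ ('n + 'm)"
    by (rule bounded_linear_imp_has_derivative[OF bounded_linear_greek_part])
  have jd: "((\<lambda>x. join 0 (g (greek_part x))) has_derivative (\<lambda>a. join 0 (g' (greek_part a)))) (at x)"
    if "(g has_derivative g') (at (greek_part x))" for g g' and x :: "real ^ ('n + 'm)"
    using bounded_linear.has_derivative[OF bounded_linear_join_0 diff_chain_at[OF gd that]]
    by (simp add: comp_def)
  \<comment> \<open>The Jacobian is needed on all of the domain of \<open>e\<close>, since the coordinate fields of \<open>e\<close>
    will be differentiated.\<close>
  have jac_ec: "jacobian e c q a = a + join 0 (frechet_derivative f (at (greek_part (coord c q))) (greek_part a))"
    if q: "q \<in> dom_of e" for q a
  proof -
    have gq: "greek_part (coord e q) = greek_part (coord c q)" by (simp add: e(3))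
    have "((\<lambda>x. x + join 0 (f (greek_part x))) has_derivative
        (\<lambda>a. a + join 0 (frechet_derivative f (at (greek_part (coord e q))) (greek_part a)))) (at (coord e q))"
      using fd[OF e(2)[OF q]] unfolding gq[symmetric] by (intro has_derivative_add has_derivative_ident jd)
    then have "(transition e c has_derivative
        (\<lambda>a. a + join 0 (frechet_derivative f (at (greek_part (coord e q))) (greek_part a)))) (at (coord e q))"
      by (rule has_derivative_transform_within_open[OF _ open_coord_image[OF M eA open_UNIV]])
        (use q straight(3) in auto)
    then show ?thesis unfolding gq[symmetric] by (rule fun_cong[OF frechet_derivative_at[symmetric]])
  qed
  \<comment> \<open>The opposite Jacobian is obtained by inverting the previous one, which fixes the Greek
    components.\<close>
  have jac_ce: "jacobian c e p w $ Inr k = w $ Inr k - (\<Sum>b\<in>UNIV. u1 k b * w $ Inl b)" for w k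
  proof -
    have yV: "y \<in> V" using e(2)[OF pe] by (simp add: y_def z_def)
    let ?a = "jacobian c e p w"
    have w: "w = ?a + join 0 (frechet_derivative f (at y) (greek_part ?a))"
      using jacobian_cocycle[OF M c eA c pc pe pc, of w] jacobian_refl[OF M c pc] jac_ec[OF pe]
      by (simp add: y_def z_def)
    then have "greek_part w = greek_part (?a + join 0 (frechet_derivative f (at y) (greek_part ?a)))"
      by (rule arg_cong)
    then have g: "greek_part ?a = greek_part w" by simp
    have "w $ Inr k = ?a $ Inr k + frechet_derivative f (at y) (greek_part w) $ k"
      using arg_cong[OF w, of "\<lambda>v. v $ Inr k"] unfolding g by simp
    then show ?thesis
      unfolding frechet_derivative_partial_deriv[OF differentiableI[OF fd[OF yV]]]
      by (simp add: u1 y_def z_def mult.commute)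
  qed
  have field: "coord_field A e (Inl x) q c = axis (Inl x) 1 + join 0 (partial_deriv x f (greek_part (coord c q)))"
    if "q \<in> dom_of e" for q x
    using that e(1) c jac_ec[OF that] by (auto simp: coord_field_def partial_deriv_def)
  have frame: "coord_field A e (Inl x) p c $ B = adapted_frame u1 x B" for x B
    by (cases B) (auto simp: field[OF pe] adapted_frame_def axis_def delta_def u1)
  have "christoffel A nabla e p (Inl l) (Inr k) (Inl x)
      = u2 k x l + normal_part (christoffel A nabla c p) u1 k l x" for k l x
  proof -
    let ?X = "coord_field A e (Inl l)" and ?Y = "coord_field A e (Inl x)"
    have F: "vector_field A (dom_of e) (coord_field A e B)" for B by (rule vector_field_coord_field[OF M eA])
    have t: "nabla p (?X p) ?Y \<in> tangent_space A p"
      by (rule vector_field_tangent[OF M nabla_vector_field[OF M conn D F F] pe])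
    have yV: "y \<in> V" using e(2)[OF pe] by (simp add: y_def z_def)
    have "(partial_deriv x f has_derivative frechet_derivative (partial_deriv x f) (at y)) (at y)"
      using smooth_on_differentiable[OF smooth_on_frechet_derivative[OF f, of "axis x 1"] yV]
      unfolding partial_deriv_def frechet_derivative_works .
    then have "((\<lambda>v. axis (Inl x) 1 + join 0 (partial_deriv x f (greek_part v))) has_derivative
        (\<lambda>a. 0 + join 0 (frechet_derivative (partial_deriv x f) (at y) (greek_part a)))) (at z)"
      unfolding y_def by (intro has_derivative_add has_derivative_const jd)
    then have "((\<lambda>v. ?Y (coord_inv c v) c) has_derivative
        (\<lambda>a. 0 + join 0 (frechet_derivative (partial_deriv x f) (at y) (greek_part a)))) (at z)"
    proof (rule has_derivative_transform_within_open[OF _ open_coord_image[OF M c D]])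
      show "z \<in> coord c ` (dom_of e \<inter> dom_of c)" using pe pc by (simp add: z_def)
      fix v assume "v \<in> coord c ` (dom_of e \<inter> dom_of c)"
      then obtain q where "q \<in> dom_of e" "coord_inv c v = q" "v = coord c q"
        using coord_inv_coord[OF M c] by auto
      then show "axis (Inl x) 1 + join 0 (partial_deriv x f (greek_part v)) = ?Y (coord_inv c v) c"
        by (simp add: field)
    qed
    from fun_cong[OF frechet_derivative_at[OF this, symmetric], of "?X p c"]
    have d: "frechet_derivative (\<lambda>v. ?Y (coord_inv c v) c) (at (coord c p)) (?X p c)
        = join 0 (partial_deriv l (partial_deriv x f) y)"
      by (simp add: field[OF pe] partial_deriv_def z_def)
    have w: "nabla p (?X p) ?Y c $ C = join 0 (partial_deriv l (partial_deriv x f) y) $ C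
        + frame_contraction (christoffel A nabla c p) u1 C l x" for C
      unfolding nabla_in_chart[OF M conn c pc D pe coord_field_tangent[OF M eA pe] F] d frame
        frame_contraction_def ..
    show ?thesis
      unfolding christoffel_def[of A nabla e] tangent_space_transform[OF M t c eA pc pe] jac_ce w normal_part_def
      by (simp add: u2 y_def z_def)
  qed
  then show ?thesis
    using second_fundamental_form_vanishes_slice[OF conn straight(1) _ pe] p by simp
qed

end

section \<open>Coefficients of the local equation\<close>

lemma sum_UNIV_Plus:
  "(\<Sum>B\<in>UNIV. g B) = (\<Sum>l\<in>UNIV. g (Inl l)) + (\<Sum>i\<in>UNIV. g (Inr i))"
  for g :: "'n::finite + 'm::finite \<Rightarrow> real"
  using sum.Plus[of "UNIV :: 'n set" "UNIV :: 'm set" g] by (simp add: comp_def)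

lemma sum_delta_mult:
  "(\<Sum>j\<in>UNIV. delta j i * g j) = g i" "(\<Sum>j\<in>UNIV. delta i j * g j) = g i" for i :: "'a::finite"
  by (simp_all add: delta_def if_distrib[of "\<lambda>t. t * _"] cong: if_cong)

lemma sum_delta_mult_scaled:
  "(\<Sum>j\<in>UNIV. s * delta j i * g j) = s * g i"
  "(\<Sum>j\<in>UNIV. delta j i * s * g j) = s * g i"
  "(\<Sum>j\<in>UNIV. r * (delta j i * s) * g j) = r * s * g i"
  "(\<Sum>j\<in>UNIV. delta j i * s * r * g j) = s * r * g i" for i :: "'a::finite"
  by (simp_all add: delta_def if_distrib[of "\<lambda>t. t * _"] if_distrib[of "\<lambda>t. _ * t"] cong: if_cong)

lemma frame_contraction_expand:
  "frame_contraction G u C l x = G (Inl l) C (Inl x)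
    + ((\<Sum>i\<in>UNIV. u i x * G (Inl l) C (Inr i)) + (\<Sum>j\<in>UNIV. u j l * G (Inr j) C (Inl x)))
    + (\<Sum>j\<in>UNIV. \<Sum>i\<in>UNIV. u j l * u i x * G (Inr j) C (Inr i))"
  unfolding frame_contraction_def sum_UNIV_Plus adapted_frame_def
  by (simp add: sum_delta_mult sum.distrib mult.assoc sum_distrib_left[symmetric])

text \<open>These are the homogeneous components of \<open>normal_part G u\<close> as a polynomial in \<open>u\<close>. The
  quadratic one is given through a bilinear form whose value at two elementary matrices is
  \<open>quantity2\<close>, in the same arrangement of indices.\<close>

definition linear_part ::
  "('n::finite + 'm::finite \<Rightarrow> 'n + 'm \<Rightarrow> 'n + 'm \<Rightarrow> real) \<Rightarrow> ('m \<Rightarrow> 'n \<Rightarrow> real) \<Rightarrow> 'm \<Rightarrow> 'n \<Rightarrow> 'n \<Rightarrow> real"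
  where "linear_part G u k l x =
    (\<Sum>i\<in>UNIV. u i x * G (Inl l) (Inr k) (Inr i)) + (\<Sum>j\<in>UNIV. u j l * G (Inr j) (Inr k) (Inl x))
    - (\<Sum>b\<in>UNIV. u k b * G (Inl l) (Inl b) (Inl x))"

definition bilinear_part ::
  "('n::finite + 'm::finite \<Rightarrow> 'n + 'm \<Rightarrow> 'n + 'm \<Rightarrow> real) \<Rightarrow> ('m \<Rightarrow> 'n \<Rightarrow> real) \<Rightarrow> ('m \<Rightarrow> 'n \<Rightarrow> real) \<Rightarrow>
    'm \<Rightarrow> 'n \<Rightarrow> 'n \<Rightarrow> real"
  where "bilinear_part G u v k l x =
    (\<Sum>j\<in>UNIV. \<Sum>i\<in>UNIV. u j l * v i x * G (Inr j) (Inr k) (Inr i))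
    - (\<Sum>b\<in>UNIV. v k b * (\<Sum>j\<in>UNIV. u j x * G (Inl l) (Inl b) (Inr j)))
    - (\<Sum>b\<in>UNIV. v k b * (\<Sum>j\<in>UNIV. u j l * G (Inr j) (Inl b) (Inl x)))"

definition cubic_part ::
  "('n::finite + 'm::finite \<Rightarrow> 'n + 'm \<Rightarrow> 'n + 'm \<Rightarrow> real) \<Rightarrow> ('m \<Rightarrow> 'n \<Rightarrow> real) \<Rightarrow> 'm \<Rightarrow> 'n \<Rightarrow> 'n \<Rightarrow> real"
  where "cubic_part G u k l x =
    (\<Sum>b\<in>UNIV. u k b * (\<Sum>j\<in>UNIV. \<Sum>i\<in>UNIV. u j l * u i x * G (Inr j) (Inl b) (Inr i)))"

lemma normal_part_scaled:
  "normal_part G (\<lambda>i a. t * u i a) k l x = G (Inl l) (Inr k) (Inl x)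
    + t * linear_part G u k l x + t^2 * bilinear_part G u u k l x - t^3 * cubic_part G u k l x"
  unfolding normal_part_def frame_contraction_expand linear_part_def bilinear_part_def cubic_part_def
  by (simp add: algebra_simps sum.distrib sum_distrib_left power2_eq_square power3_eq_cube)

lemma cubic_real_polynomial_zero:
  fixes a b c d :: real
  assumes "\<And>t. a + t * b + t^2 * c - t^3 * d = 0"
  shows "a = 0" "b = 0" "c = 0" "d = 0"
  using assms[of 0] assms[of 1] assms[of "-1"] assms[of 2] by simp_all

lemma bilinear_part_add:
  "bilinear_part G (\<lambda>i a. u i a + v i a) (\<lambda>i a. u i a + v i a) k l x =
    bilinear_part G u u k l x + bilinear_part G u v k l x + bilinear_part G v u k l x + bilinear_part G v v k l x"
  unfolding bilinear_part_def
  by (simp add: algebra_simps sum.distrib)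

lemma symmetric_quadratic_form_zero:
  fixes g :: "'m::finite \<Rightarrow> 'm \<Rightarrow> real"
  assumes sym: "\<And>j i. g j i = g i j" and 0: "\<And>w. (\<Sum>j\<in>UNIV. \<Sum>i\<in>UNIV. w j * w i * g j i) = 0"
  shows "g j i = 0"
proof -
  have d: "g j j = 0" for j
    using 0[of "\<lambda>r. delta r j"] by (simp add: mult.assoc sum_delta_mult sum_distrib_left[symmetric])
  have "(\<Sum>r\<in>UNIV. \<Sum>s\<in>UNIV. (delta r j + delta r i) * (delta s j + delta s i) * g r s)
      = g j j + g j i + g i j + g i i"
    by (simp add: distrib_right distrib_left sum.distrib mult.assoc sum_delta_mult sum_distrib_left[symmetric])
  then show ?thesis using 0[of "\<lambda>r. delta r j + delta r i"] d sym[of j i] by simp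
qed

text \<open>A cubic polynomial in \<open>u\<close> that vanishes identically has vanishing homogeneous components, and
  elementary matrices pick out the coefficients. The linear component gives
  \<open>quantity1\<close> directly. The bilinear form is only known to vanish on the diagonal, so polarization
  yields its symmetrization, \<open>quantity2_sym\<close>. For \<open>quantity3\<close>, matrices \<open>u\<close> with a single nonzero
  column \<open>w\<close>, in position \<open>b\<close>, turn the cubic component into \<open>w\<^sup>k\<close> times the quadratic form of
  \<open>G\<^sub>j\<^sup>b\<^sub>i\<close> at \<open>w\<close>. That form therefore vanishes, and so do its coefficients, which are
  symmetric.\<close>

lemma normal_part_zero_imp_quantities_zero:
  fixes G :: "'n::finite + 'm::finite \<Rightarrow> 'n + 'm \<Rightarrow> 'n + 'm \<Rightarrow> real"
  assumes sym: "\<And>a C b. G a C b = G b C a" and N: "\<And>u k l x. normal_part G u k l x = 0"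
  shows "quantity0 G l x k = 0" "quantity1 G l x b k i = 0" "quantity2_sym G l x a b k j i = 0"
    "quantity3 G b j i = 0"
proof -
  have P: "G (Inl l) (Inr k) (Inl x) + t * linear_part G u k l x + t^2 * bilinear_part G u u k l x
      - t^3 * cubic_part G u k l x = 0" for u k l x t
    using N[of "\<lambda>i a. t * u i a"] unfolding normal_part_scaled .
  note zero = cubic_real_polynomial_zero[OF P]
  \<comment> \<open>the matrix with a single entry \<open>1\<close>, at \<open>(j, a)\<close>\<close>
  let ?E = "\<lambda>j a (r::'m) (g::'n). delta r j * delta g a"
  show "quantity0 G l x k = 0" unfolding quantity0_def by (rule zero(1))
  have "linear_part G (?E i b) k l x = quantity1 G l x b k i"
    unfolding linear_part_def quantity1_def
    by (simp only: sum_delta_mult_scaled) (simp add: delta_def)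
  then show "quantity1 G l x b k i = 0" using zero(2) by simp
  have q2: "bilinear_part G (?E j a) (?E i b) k l x = quantity2 G l x a b k j i" for j a i b
    unfolding bilinear_part_def quantity2_def
    by (simp only: sum_delta_mult_scaled) (simp add: delta_def)
  have "bilinear_part G (?E j a) (?E i b) k l x + bilinear_part G (?E i b) (?E j a) k l x = 0"
    using zero(3)[of "\<lambda>r g. ?E j a r g + ?E i b r g" k l x] zero(3)[of "?E j a" k l x] zero(3)[of "?E i b" k l x]
    unfolding bilinear_part_add by simp
  then show "quantity2_sym G l x a b k j i = 0" unfolding quantity2_sym_def q2 by simp
  have "(\<Sum>j\<in>UNIV. \<Sum>i\<in>UNIV. w j * w i * G (Inr j) (Inl b) (Inr i)) = 0" for w :: "'m \<Rightarrow> real"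
  proof (cases "w = (\<lambda>_. 0)")
    case False
    then obtain k where k: "w k \<noteq> 0" by auto
    let ?q = "\<lambda>g. \<Sum>j\<in>UNIV. \<Sum>i\<in>UNIV. w j * w i * G (Inr j) (Inl g) (Inr i)"
    have "cubic_part G (\<lambda>r g. w r * delta g b) k b b = (\<Sum>g\<in>UNIV. delta g b * (w k * ?q g))"
      unfolding cubic_part_def by (simp add: delta_def mult_ac)
    then have "w k * ?q b = 0" unfolding sum_delta_mult using zero(4) by simp
    then show ?thesis using k by simp
  qed simp
  then show "quantity3 G b j i = 0"
    unfolding quantity3_def
    by (rule symmetric_quadratic_form_zero[of "\<lambda>j i. G (Inr j) (Inl b) (Inr i)", OF sym])
qed

lemma frame_contraction_diff:
  "frame_contraction (\<lambda>a C b. G a C b - H a C b) u C l x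
    = frame_contraction G u C l x - frame_contraction H u C l x"
  by (simp add: frame_contraction_def sum_subtractf algebra_simps)

lemma normal_part_diff:
  "normal_part (\<lambda>a C b. G a C b - H a C b) u k l x = normal_part G u k l x - normal_part H u k l x"
  by (simp add: normal_part_def frame_contraction_diff sum_subtractf algebra_simps)

lemma frame_contraction_symmetric:
  assumes "\<And>a C b. G a C b = G b C a"
  shows "frame_contraction G u C l x = frame_contraction G u C x l"
  unfolding frame_contraction_def by (subst sum.swap) (simp add: assms[of _ C] mult_ac)

lemma normal_part_symmetric:
  assumes "\<And>a C b. G a C b = G b C a"
  shows "normal_part G u k l x = normal_part G u k x l"
  unfolding normal_part_def frame_contraction_symmetric[of G u _ l x, OF assms] ..

section \<open>Comparison of equivalent connections\<close>

context
  fixes A :: "('e::{t2_space, second_countable_topology}, 'n::finite, 'm::finite) chart set"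
  assumes M: "smooth_manifold A"
begin

text \<open>Every second-order jet is attained by the graph of its Taylor polynomial; the symmetry of
  \<open>u2\<close> is necessary because second derivatives commute.\<close>

lemma submanifold_with_jet_exists:
  fixes c :: "('e, 'n, 'm) chart"
  assumes c: "c \<in> A" and p: "p \<in> dom_of c" and sym: "\<And>k l x. u2 k l x = u2 k x l"
  shows "\<exists>L. submanifold A L \<and> p \<in> L \<and> jet_coords c L p u1 u2"
proof -
  define y where "y = greek_part (coord c p)"
  define y0 :: "real ^ 'm" where "y0 = (\<chi> i. coord c p $ Inr i)"
  define U :: "'n \<Rightarrow> real ^ 'm" where "U l = (\<chi> k. u1 k l)" for l
  define Q :: "'n \<Rightarrow> 'n \<Rightarrow> real ^ 'm" where "Q l x = (\<chi> k. u2 k l x)" for l x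
  define f where "f v = y0 + (\<Sum>l\<in>UNIV. (v $ l - y $ l) *\<^sub>R
      (U l + (\<Sum>x\<in>UNIV. ((v $ x - y $ x) / 2) *\<^sub>R Q l x)))" for v
  have Qsym: "Q l x = Q x l" for l x by (simp add: Q_def sym[of _ l x])
  have lin: "smooth_on (\<lambda>v. v $ l - y $ l) (UNIV :: (real ^ 'n) set)" for l
    using smooth_on_add[OF open_UNIV smooth_on_bounded_linear[OF bounded_linear_vec_nth[of l]]
        smooth_on_const[of "- y $ l"]] by simp
  have half: "smooth_on (\<lambda>v. (v $ l - y $ l) / 2) (UNIV :: (real ^ 'n) set)" for l
    by (rule smooth_on_linear_compose[OF bounded_linear_divide open_UNIV lin])
  have f_smooth: "smooth_on f UNIV"
    unfolding f_def by (intro smooth_on_add smooth_on_sum smooth_on_scaleR smooth_on_const open_UNIV lin half)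
  have nd: "((\<lambda>v. v $ l - y $ l) has_derivative (\<lambda>h. h $ l)) (at v)" for l and v :: "real ^ 'n"
    using has_derivative_diff[OF bounded_linear_imp_has_derivative[OF bounded_linear_vec_nth[of l]]
        has_derivative_const[of "y $ l"]] by simp
  have nd2: "((\<lambda>v. (v $ l - y $ l) / 2) has_derivative (\<lambda>h. h $ l / 2)) (at v)" for l and v :: "real ^ 'n"
    by (rule bounded_linear.has_derivative[OF bounded_linear_divide nd])
  have df: "partial_deriv b f v = U b + (\<Sum>x\<in>UNIV. (v $ x - y $ x) *\<^sub>R Q b x)" for b v
  proof -
    have ax: "(\<Sum>x\<in>UNIV. (axis b 1 $ x / 2) *\<^sub>R Q l x) = (1 / 2) *\<^sub>R Q b l" for l
      by (simp add: axis_def if_distrib[of "\<lambda>t. (t / 2) *\<^sub>R _"] Qsym[of l b] cong: if_cong)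
    have "(f has_derivative (\<lambda>h. 0 + (\<Sum>l\<in>UNIV. (v $ l - y $ l) *\<^sub>R (0 + (\<Sum>x\<in>UNIV. (h $ x / 2) *\<^sub>R Q l x))
        + h $ l *\<^sub>R (U l + (\<Sum>x\<in>UNIV. ((v $ x - y $ x) / 2) *\<^sub>R Q l x))))) (at v)"
      unfolding f_def
      by (intro has_derivative_add has_derivative_const has_derivative_sum has_derivative_scaleR
          has_derivative_scaleR_left nd nd2)
    from fun_cong[OF frechet_derivative_at[OF this, symmetric], of "axis b 1"]
    have "partial_deriv b f v = (\<Sum>l\<in>UNIV. (v $ l - y $ l) *\<^sub>R (\<Sum>x\<in>UNIV. (axis b 1 $ x / 2) *\<^sub>R Q l x))
        + (\<Sum>l\<in>UNIV. axis b 1 $ l *\<^sub>R (U l + (\<Sum>x\<in>UNIV. ((v $ x - y $ x) / 2) *\<^sub>R Q l x)))"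
      by (simp add: partial_deriv_def sum.distrib)
    also have "(\<Sum>l\<in>UNIV. axis b 1 $ l *\<^sub>R (U l + (\<Sum>x\<in>UNIV. ((v $ x - y $ x) / 2) *\<^sub>R Q l x)))
        = U b + (\<Sum>x\<in>UNIV. ((v $ x - y $ x) / 2) *\<^sub>R Q b x)"
      by (simp add: axis_def if_distrib[of "\<lambda>t. t *\<^sub>R _"] cong: if_cong)
    finally have "partial_deriv b f v = (\<Sum>x\<in>UNIV. ((v $ x - y $ x) / 2) *\<^sub>R Q b x)
        + (U b + (\<Sum>x\<in>UNIV. ((v $ x - y $ x) / 2) *\<^sub>R Q b x))"
      unfolding ax by simp
    also have "\<dots> = U b + (\<Sum>x\<in>UNIV. ((v $ x - y $ x) / 2) *\<^sub>R Q b x + ((v $ x - y $ x) / 2) *\<^sub>R Q b x)"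
      by (simp only: sum.distrib add_ac)
    finally show ?thesis unfolding scaleR_add_left[symmetric] by simp
  qed
  have ddf: "partial_deriv x (partial_deriv l f) y = Q l x" for l x
  proof -
    have "((\<lambda>v. U l + (\<Sum>x\<in>UNIV. (v $ x - y $ x) *\<^sub>R Q l x)) has_derivative
        (\<lambda>h. 0 + (\<Sum>x\<in>UNIV. h $ x *\<^sub>R Q l x))) (at y)"
      by (intro has_derivative_add has_derivative_const has_derivative_sum has_derivative_scaleR_left nd)
    then have "(partial_deriv l f has_derivative (\<lambda>h. 0 + (\<Sum>x\<in>UNIV. h $ x *\<^sub>R Q l x))) (at y)"
      unfolding df[abs_def] .
    from fun_cong[OF frechet_derivative_at[OF this, symmetric], of "axis x 1"]
    show ?thesis
      by (simp add: partial_deriv_def[of x] axis_def if_distrib[of "\<lambda>t. t *\<^sub>R _"] cong: if_cong)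
  qed
  \<comment> \<open>The polynomial is defined everywhere, but only the part of its graph that lies in the image
    of the chart is a subset of the manifold.\<close>
  define V where "V = (\<lambda>v. join v (f v)) -` (coord c ` dom_of c)"
  define L where "L = {q \<in> dom_of c. \<exists>v. coord c q = join v (f v)}"
  have "continuous_on UNIV (\<lambda>v. join v (f v))"
    unfolding join_def
  proof (rule continuous_on_vec_lambda)
    fix B
    show "continuous_on UNIV (\<lambda>v. case B of Inl l \<Rightarrow> v $ l | Inr i \<Rightarrow> f v $ i)"
      using smooth_on_continuous_on[OF f_smooth]
      by (cases B) (auto intro: continuous_on_component continuous_on_id)
  qed
  then have V: "open V"
    using open_vimage[of "coord c ` dom_of c"] open_coord_image[OF M c open_UNIV] by (simp add: V_def)
  have graph: "coord c ` (L \<inter> dom_of c) = (\<lambda>v. join v (f v)) ` V"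
    by (auto simp: L_def V_def image_iff)
  have fV: "smooth_on f V" by (rule smooth_on_subset[OF f_smooth]) simp
  note straight = graph_straightening_chart[OF M c chart_open_dom[OF M c] order_refl V fV graph]
  have "L \<subseteq> dom_of c" by (auto simp: L_def)
  then have "submanifold A L" unfolding submanifold_def using straight(1,2) by blast
  moreover have "coord c p = join y (f y)"
    by (simp add: vec_eq_sum_iff y_def y0_def f_def)
  then have "p \<in> L" using p by (auto simp: L_def)
  moreover have "jet_coords c L p u1 u2"
    unfolding jet_coords_def Let_def greek_part_def[symmetric] y_def[symmetric]
    by (rule exI[of _ "dom_of c"], rule exI[of _ V], rule exI[of _ f])
      (use p \<open>p \<in> L\<close> chart_open_dom[OF M c] V fV graph in \<open>simp add: ddf df U_def Q_def\<close>)
  ultimately show ?thesis by blast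
qed

text \<open>A point of the totally geodesic equation is a contact class, and the second fundamental form
  is only known to vanish for some representative. Hence equality of the two equations does not give
  back \<open>L\<close> itself but a submanifold \<open>L'\<close> in contact of order two with it.\<close>

lemma grassmannian_equivalent_same_jets:
  assumes eq: "grassmannian_equivalent A nabla nabla'"
    and L: "submanifold A L" "p \<in> L" and S: "second_fundamental_form_vanishes A nabla L p"
  shows "\<exists>L'. second_fundamental_form_vanishes A nabla' L' p \<and>
    (\<forall>c\<in>A. p \<in> dom_of c \<longrightarrow> (\<forall>u1 u2. jet_coords c L p u1 u2 \<longrightarrow> jet_coords c L' p u1 u2))"
proof -
  have "contact_class A L p \<in> totally_geodesic_equation A nabla"
    using L S unfolding totally_geodesic_equation_def J2_def by blast
  then have "contact_class A L p \<in> totally_geodesic_equation A nabla'"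
    using eq unfolding grassmannian_equivalent_def by simp
  then obtain L' p' where L': "submanifold A L'" "p' \<in> L'" "contact_class A L p = contact_class A L' p'"
      and S': "second_fundamental_form_vanishes A nabla' L' p'"
    unfolding totally_geodesic_equation_def by blast
  have "(L', p') \<in> contact_class A L p"
    unfolding L'(3) using L'(1,2) by (simp add: contact_class_def contact2_def)
  then have "((L, p), (L', p')) \<in> contact2 A"
    unfolding contact_class_def by simp
  then have "p' = p" "\<forall>c\<in>A. p \<in> dom_of c \<longrightarrow> (\<forall>u1 u2. jet_coords c L p u1 u2 \<longrightarrow> jet_coords c L' p u1 u2)"
    unfolding contact2_def by auto
  then show ?thesis using S' by blast
qed

text \<open>The local equation is solved for the second derivatives, so over any prescribed first
  derivatives \<open>u\<close> there is a totally geodesic jet of \<open>nabla\<close>, with second derivatives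
  \<open>- normal_part\<close>. This jet also satisfies the equation of \<open>nabla'\<close>. Torsion-freeness of \<open>nabla\<close>
  makes the required second derivatives symmetric.\<close>

lemma grassmannian_equivalent_normal_part:
  fixes nabla nabla' :: "('e, 'n, 'm) cov_deriv"
  assumes conn: "linear_connection A nabla" "torsion_free A nabla" and conn': "linear_connection A nabla'"
    and eq: "grassmannian_equivalent A nabla nabla'" and c: "c \<in> A" "p \<in> dom_of c"
  shows "normal_part (christoffel A nabla' c p) u k l x = normal_part (christoffel A nabla c p) u k l x"
proof -
  let ?N = "normal_part (christoffel A nabla c p) u"
  have sym: "?N k l x = ?N k x l" for k l x
    by (rule normal_part_symmetric) (rule christoffel_symmetric[OF M conn c])
  have "- ?N k l x = - ?N k x l" for k l x by (simp add: sym[of k l x])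
  from submanifold_with_jet_exists[OF c, of "\<lambda>k l x. - ?N k l x", OF this]
  obtain L where L: "submanifold A L" "p \<in> L" "jet_coords c L p u (\<lambda>k l x. - ?N k l x)" by blast
  have "second_fundamental_form_vanishes A nabla L p"
    unfolding totally_geodesic_local_equation[OF M conn(1) c(1) L(3)] using sym by simp
  from grassmannian_equivalent_same_jets[OF eq L(1,2) this] c L(3)
  obtain L' where S': "second_fundamental_form_vanishes A nabla' L' p"
    and jet': "jet_coords c L' p u (\<lambda>k l x. - ?N k l x)" by blast
  have "- ?N k x l + normal_part (christoffel A nabla' c p) u k l x = 0"
    using S' unfolding totally_geodesic_local_equation[OF M conn' c(1) jet'] by blast
  then show ?thesis using sym[of k l x] by simp
qed

end

theorem proposition2:
  fixes A :: "('e::{t2_space, second_countable_topology}, 'n::finite, 'm::finite) chart set"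
    and nabla nabla' :: "('e, 'n, 'm) cov_deriv"
    and c :: "('e, 'n, 'm) chart" and p :: 'e
  defines "\<Gamma> \<equiv> christoffel A nabla c p" and "\<Gamma>' \<equiv> christoffel A nabla' c p"
  assumes "smooth_manifold A"
    and "linear_connection A nabla" "torsion_free A nabla"
    and "linear_connection A nabla'" "torsion_free A nabla'"
    and "grassmannian_equivalent A nabla nabla'"
    and "c \<in> A" "p \<in> dom_of c"
  shows "(\<forall>l x k. quantity0 \<Gamma>' l x k = quantity0 \<Gamma> l x k) \<and>
    (\<forall>l x b k i. quantity1 \<Gamma>' l x b k i = quantity1 \<Gamma> l x b k i) \<and>
    (\<forall>l x a b k j i. quantity2_sym \<Gamma>' l x a b k j i = quantity2_sym \<Gamma> l x a b k j i) \<and>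
    (\<forall>b j i. quantity3 \<Gamma>' b j i = quantity3 \<Gamma> b j i)"
proof -
  define G where "G a C b = \<Gamma>' a C b - \<Gamma> a C b" for a C b
  have sym: "G a C b = G b C a" for a C b
    using christoffel_symmetric[OF assms(3,4,5,9,10), of a C b] christoffel_symmetric[OF assms(3,6,7,9,10), of a C b]
    by (simp add: G_def \<Gamma>_def \<Gamma>'_def)
  have N: "normal_part G u k l x = 0" for u k l x
    unfolding G_def[abs_def] normal_part_diff \<Gamma>_def \<Gamma>'_def
    using grassmannian_equivalent_normal_part[OF assms(3-6,8-10)] by simp
  have diff: "quantity0 G l x k = quantity0 \<Gamma>' l x k - quantity0 \<Gamma> l x k"
    "quantity1 G l x b k i = quantity1 \<Gamma>' l x b k i - quantity1 \<Gamma> l x b k i"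
    "quantity2 G l x a b k j i = quantity2 \<Gamma>' l x a b k j i - quantity2 \<Gamma> l x a b k j i"
    "quantity3 G b j i = quantity3 \<Gamma>' b j i - quantity3 \<Gamma> b j i" for l x a b k j i
    by (simp_all add: G_def quantity0_def quantity1_def quantity2_def quantity3_def algebra_simps)
  have diff2: "quantity2_sym G l x a b k j i = quantity2_sym \<Gamma>' l x a b k j i - quantity2_sym \<Gamma> l x a b k j i"
    for l x a b k j i
    by (simp add: quantity2_sym_def diff field_simps)
  note zero = normal_part_zero_imp_quantities_zero[of G, OF sym N]
  show ?thesis
    using zero(1) zero(2) zero(3) zero(4) unfolding diff diff2 by simp
qed

end
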